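(* The structure group of a finite quandle $(X,\triangleleft)$ is isomorphic to $\mathbb{Z}^3$ if and only if $(X,\triangleleft)$ is abelian with $3$ orbits, and its parameters satisfy the following conditions: (1) $\gcd(m^{(1)}_1,m^{(1)}_{2,1},m^{(2)}_{2})=\gcd(m^{(1)}_{2},m^{(3)}_1,m^{(3)}_{2,1})=\gcd(m^{(2)}_1,m^{(2)}_{2,1},m^{(3)}_{2})=1$; (2) $\gcd(m^{(1)}_1,m^{(1)}_{2,1},m^{(2)}_1,m^{(3)}_{2})=\gcd(m^{(1)}_1,m^{(2)}_{2},m^{(3)}_1,m^{(3)}_{2,1})=\gcd(m^{(1)}_{2},m^{(2)}_1,m^{(2)}_{2,1},m^{(3)}_1)=1$; (3) $\gcd\big(m^{(1)}_1,\,m^{(2)}_1,\,m^{(3)}_1,\,m^{(1)}_{2,1}m^{(2)}_{2,1}m^{(3)}_{2,1}-m^{(1)}_{2}m^{(2)}_{2}m^{(3)}_{2}\big)=1$.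
   Context: A quandle is a set $X$ with a binary operation $\triangleleft$ such that for all $a,b,c$: $(a\triangleleft b)\triangleleft c=(a\triangleleft c)\triangleleft(b\triangleleft c)$; the right translation $-\triangleleft b$ is a bijection of $X$; $a\triangleleft a=a$. Its orbits are the orbits of $X$ under the group generated by all right translations. It is abelian if $(a\triangleleft b)\triangleleft c=(a\triangleleft c)\triangleleft b$ for all $a,b,c$. Its structure group is $G(X,\triangleleft)=\langle g_a,\ a\in X\mid g_ag_b=g_bg_{a\triangleleft b},\ a,b\in X\rangle$. Parameters of a $3$-orbit finite abelian quandle. For integers $m_1,m_2\ge1$ and $0\le m_{2,1}<m_1$, let $M=(m_1,m_{2,1},m_2)$ and let $G(M)$ be the finite abelian group generated by commuting $x_1,x_2$ subject to $x_1^{m_1}=1$ and $x_1^{m_{2,1}}x_2^{m_2}=1$; put $x_0:=1$. Given three such triples $M^{(i)}=(m^{(i)}_1,m^{(i)}_{2,1},m^{(i)}_2)$, $i=1,2,3$, let $Q(M^{(1)},M^{(2)},M^{(3)})=G(M^{(1)})\sqcup G(M^{(2)})\sqcup G(M^{(3)})$, with $x^{(i)}_k$ denoting the element $x_k$ of $G(M^{(i)})$, and $a\triangleleft b=a\,x_k^{(i)}$ for $a\in G(M^{(i)})$, $b\in G(M^{(i+k)})$, $0\le k\le2$ ($i+k$ modulo $3$). This is an abelian quandle with orbits $G(M^{(i)})$. Every finite abelian quandle with three ordered orbits $O_1,O_2,O_3$ is isomorphic, by an isomorphism matching $O_i$ with $G(M^{(i)})$ for each $i$, to $Q(M^{(1)},M^{(2)},M^{(3)})$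 for unique $M^{(1)},M^{(2)},M^{(3)}$; the numbers $m^{(i)}_1,m^{(i)}_{2,1},m^{(i)}_2$ are its parameters. The orbits are assumed to be ordered (an ordering is fixed). *)

theory Defs
  imports "HOL-Algebra.Group_Action" "HOL-Algebra.Elementary_Groups"
begin

section \<open>Groups given by generators and relations\<close>

text \<open>A word over \<open>S\<close> is a list of letters: \<open>(a, True)\<close> stands for the generator \<open>a\<close> and
  \<open>(a, False)\<close> for its formal inverse.  A pair \<open>(u, v)\<close> in \<open>R\<close> stands for the relation \<open>u = v\<close>.
  The congruence below is the least one on words that cancels formal inverses and contains \<open>R\<close>.\<close>

inductive word_eq ::
  "'a set \<Rightarrow> (('a \<times> bool) list \<times> ('a \<times> bool) list) set
     \<Rightarrow> ('a \<times> bool) list \<Rightarrow> ('a \<times> bool) list \<Rightarrow> bool"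
  for S R
where
  refl: "w \<in> lists (S \<times> UNIV) \<Longrightarrow> word_eq S R w w"
| sym: "word_eq S R u v \<Longrightarrow> word_eq S R v u"
| trans: "word_eq S R u v \<Longrightarrow> word_eq S R v w \<Longrightarrow> word_eq S R u w"
| app: "word_eq S R u u' \<Longrightarrow> word_eq S R v v' \<Longrightarrow> word_eq S R (u @ v) (u' @ v')"
| cancel: "a \<in> S \<Longrightarrow> word_eq S R [(a, s), (a, \<not> s)] []"
| rel: "(u, v) \<in> R \<Longrightarrow> u \<in> lists (S \<times> UNIV) \<Longrightarrow> v \<in> lists (S \<times> UNIV) \<Longrightarrow> word_eq S R u v"

definition word_class ::
  "'a set \<Rightarrow> (('a \<times> bool) list \<times> ('a \<times> bool) list) set
     \<Rightarrow> ('a \<times> bool) list \<Rightarrow> ('a \<times> bool) list set"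
  where "word_class S R w = {v. word_eq S R w v}"

definition presented_group ::
  "'a set \<Rightarrow> (('a \<times> bool) list \<times> ('a \<times> bool) list) set \<Rightarrow> ('a \<times> bool) list set monoid"
  where "presented_group S R =
    \<lparr>carrier = word_class S R ` lists (S \<times> UNIV),
     monoid.mult = (\<lambda>A B. \<Union>u\<in>A. \<Union>v\<in>B. word_class S R (u @ v)),
     one = word_class S R []\<rparr>"

section \<open>Quandles\<close>

locale quandle =
  fixes Q :: "'a set" and tri :: "'a \<Rightarrow> 'a \<Rightarrow> 'a"
  assumes self_distrib:
      "\<lbrakk>a \<in> Q; b \<in> Q; c \<in> Q\<rbrakk> \<Longrightarrow> tri (tri a b) c = tri (tri a c) (tri b c)"
    and right_translation_bij: "b \<in> Q \<Longrightarrow> bij_betw (\<lambda>a. tri a b) Q Q"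
    and idem: "a \<in> Q \<Longrightarrow> tri a a = a"

definition abelian_quandle :: "'a set \<Rightarrow> ('a \<Rightarrow> 'a \<Rightarrow> 'a) \<Rightarrow> bool"
  where "abelian_quandle Q tri \<longleftrightarrow>
    quandle Q tri \<and> (\<forall>a\<in>Q. \<forall>b\<in>Q. \<forall>c\<in>Q. tri (tri a b) c = tri (tri a c) b)"

definition translation_group :: "'a set \<Rightarrow> ('a \<Rightarrow> 'a \<Rightarrow> 'a) \<Rightarrow> ('a \<Rightarrow> 'a) monoid"
  where "translation_group Q tri =
    (BijGroup Q)\<lparr>carrier := generate (BijGroup Q) {(\<lambda>a\<in>Q. tri a b) | b. b \<in> Q}\<rparr>"

definition quandle_orbits :: "'a set \<Rightarrow> ('a \<Rightarrow> 'a \<Rightarrow> 'a) \<Rightarrow> 'a set set"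
  where "quandle_orbits Q tri = orbits (translation_group Q tri) Q (\<lambda>f. f)"

definition structure_group ::
  "'a set \<Rightarrow> ('a \<Rightarrow> 'a \<Rightarrow> 'a) \<Rightarrow> ('a \<times> bool) list set monoid"
  where "structure_group Q tri =
    presented_group Q
      {([(a, True), (b, True)], [(b, True), (tri a b, True)]) | a b. a \<in> Q \<and> b \<in> Q}"

definition quandle_isos ::
  "'a set \<Rightarrow> ('a \<Rightarrow> 'a \<Rightarrow> 'a) \<Rightarrow> 'b set \<Rightarrow> ('b \<Rightarrow> 'b \<Rightarrow> 'b) \<Rightarrow> ('a \<Rightarrow> 'b) set"
  where "quandle_isos Q tri Y tri' =
    {f. bij_betw f Q Y \<and> (\<forall>a\<in>Q. \<forall>b\<in>Q. f (tri a b) = tri' (f a) (f b))}"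

section \<open>Parameters of an abelian quandle with three ordered orbits\<close>

text \<open>The abelian group on commuting generators \<open>x\<^sub>1, x\<^sub>2\<close> with relations \<open>x\<^sub>1\<^bsup>m1\<^esup> = 1\<close> and
  \<open>x\<^sub>1\<^bsup>m21\<^esup> x\<^sub>2\<^bsup>m2\<^esup> = 1\<close>: the pair \<open>(u, v)\<close> of integers represents \<open>x\<^sub>1\<^bsup>u\<^esup> x\<^sub>2\<^bsup>v\<^esup>\<close>.\<close>

definition relation_lattice :: "int \<Rightarrow> int \<Rightarrow> int \<Rightarrow> (int \<times> int) set"
  where "relation_lattice m1 m21 m2 =
    generate (integer_group \<times>\<times> integer_group) {(m1, 0), (m21, m2)}"

definition param_group :: "int \<Rightarrow> int \<Rightarrow> int \<Rightarrow> (int \<times> int) set monoid"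
  where "param_group m1 m21 m2 =
    (integer_group \<times>\<times> integer_group) Mod relation_lattice m1 m21 m2"

text \<open>The elements \<open>x\<^sub>0 = 1\<close>, \<open>x\<^sub>1\<close> and \<open>x\<^sub>2\<close> (used for \<open>k \<le> 2\<close> only).\<close>

definition param_gen :: "int \<Rightarrow> int \<Rightarrow> int \<Rightarrow> nat \<Rightarrow> (int \<times> int) set"
  where "param_gen m1 m21 m2 k =
    relation_lattice m1 m21 m2 #>\<^bsub>integer_group \<times>\<times> integer_group\<^esub>
      (if k = 0 then (0, 0) else if k = 1 then (1, 0) else (0, 1))"

text \<open>The disjoint union of three such groups, indexed by 1, 2, 3.  For \<open>a\<close> in part \<open>i\<close> and
  \<open>b\<close> in part \<open>j\<close>, the number \<open>k\<close> with \<open>j = i + k\<close> modulo 3 is \<open>(j + 3 - i) mod 3\<close>.\<close>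

definition param_carrier ::
  "(nat \<Rightarrow> int) \<Rightarrow> (nat \<Rightarrow> int) \<Rightarrow> (nat \<Rightarrow> int) \<Rightarrow> (nat \<times> (int \<times> int) set) set"
  where "param_carrier m1 m21 m2 =
    (SIGMA i:{1..3}. carrier (param_group (m1 i) (m21 i) (m2 i)))"

definition param_op ::
  "(nat \<Rightarrow> int) \<Rightarrow> (nat \<Rightarrow> int) \<Rightarrow> (nat \<Rightarrow> int)
     \<Rightarrow> nat \<times> (int \<times> int) set \<Rightarrow> nat \<times> (int \<times> int) set \<Rightarrow> nat \<times> (int \<times> int) set"
  where "param_op m1 m21 m2 = (\<lambda>(i, a) (j, b).
    (i, a \<otimes>\<^bsub>param_group (m1 i) (m21 i) (m2 i)\<^esub>
          param_gen (m1 i) (m21 i) (m2 i) ((j + 3 - i) mod 3)))"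

text \<open>\<open>Orb 1\<close>, \<open>Orb 2\<close>, \<dots> enumerates the orbits in the chosen order.\<close>

definition orbit_ordering :: "'a set \<Rightarrow> ('a \<Rightarrow> 'a \<Rightarrow> 'a) \<Rightarrow> (nat \<Rightarrow> 'a set) \<Rightarrow> bool"
  where "orbit_ordering Q tri Orb \<longleftrightarrow>
    bij_betw Orb {1..card (quandle_orbits Q tri)} (quandle_orbits Q tri)"

text \<open>\<open>m1 i\<close>, \<open>m21 i\<close>, \<open>m2 i\<close> for \<open>i = 1, 2, 3\<close> are the parameters of the quandle, relative to
  the ordering \<open>Orb\<close> of its orbits; the values at other indices are irrelevant.  For an abelian
  quandle with three orbits, parameters exist and their values at 1, 2, 3 are unique.\<close>

definition has_parameters ::
  "'a set \<Rightarrow> ('a \<Rightarrow> 'a \<Rightarrow> 'a) \<Rightarrow> (nat \<Rightarrow> 'a set)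
     \<Rightarrow> (nat \<Rightarrow> int) \<Rightarrow> (nat \<Rightarrow> int) \<Rightarrow> (nat \<Rightarrow> int) \<Rightarrow> bool"
  where "has_parameters Q tri Orb m1 m21 m2 \<longleftrightarrow>
    (\<forall>i\<in>{1..3}. 1 \<le> m1 i \<and> 1 \<le> m2 i \<and> 0 \<le> m21 i \<and> m21 i < m1 i) \<and>
    (\<exists>f \<in> quandle_isos Q tri (param_carrier m1 m21 m2) (param_op m1 m21 m2).
       \<forall>i\<in>{1..3}. f ` Orb i = {i} \<times> carrier (param_group (m1 i) (m21 i) (m2 i)))"

end

theory Submission
  imports Defs "HOL-Algebra.Free_Abelian_Groups" "HOL-Algebra.Multiplicative_Group"
    "HOL-Computational_Algebra.Primes"
begin

text \<open>If the structure group \<open>G\<close> is abelian, then the right translations commute and \<open>G\<close> is free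
  abelian on the orbits; so the question is when an abelian quandle with three orbits has an
  abelian structure group.  In the structure group of an abelian quandle the commutator of two
  generators depends only on their orbits, so there are three commutators
  \<open>A = c\<^sub>1\<^sub>2, B = c\<^sub>2\<^sub>3, C = c\<^sub>3\<^sub>1\<close>, and the presentations of the three orbits turn into the relations
  \<open>A\<^bsup>m1 1\<^esup> = 1\<close>, \<open>A\<^bsup>m21 1\<^esup> = C\<^bsup>m2 1\<^esup>\<close> and their cyclic shifts.  The coprimality conditions say that
  these relations have only the trivial solution modulo every prime, so they force
  \<open>A = B = C = 1\<close>.  Conversely, a solution modulo \<open>p\<close> yields a homomorphism from \<open>G\<close> to a central
  extension of \<open>\<int>\<^sup>3\<close> by \<open>\<int>/p\<close> in which the generators have commutators \<open>A, B, C\<close>.\<close>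

section \<open>Presented groups\<close>

text \<open>The relations come from closed walks. Translating \<open>a\<close> by \<open>b\<close>
  multiplies the generator of \<open>a\<close> on the right by their commutator, and this factor
  stays the same along both orbits; so a sequence of translations that returns to its start yields a
  relation. The two generators of \<open>relation_lattice\<close> are such loops in orbit i:
  \<open>m1 i\<close> translations by orbit i+1, or \<open>m21 i\<close> translations by orbit i+1
  followed by \<open>m2 i\<close> by orbit i+2. The second loop involves the inverse of a cyclic
  commutator, which then moves to the other side of the equation. Written additively, the relations
  of the second kind form a cyclic 3 by 3 matrix whose determinant is the last entry in condition
  (3). The 3 + 3 + 1 conditions sort the nonzero solutions by support: one, two or all three of A,
  B, C nonzero modulo a prime. In the converse the modulus \<open>p\<close> may be any positive
  integer, so it can be the gcd itself. The number 3 of orbits is recovered as the rank of a free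
  abelian group.\<close>

lemma word_eq_lists:
  assumes "word_eq S R u v"
  shows "u \<in> lists (S \<times> UNIV)" "v \<in> lists (S \<times> UNIV)"
  using assms by (induction rule: word_eq.induct) auto

lemma word_class_eq_iff:
  assumes "u \<in> lists (S \<times> UNIV)"
  shows "word_class S R u = word_class S R v \<longleftrightarrow> word_eq S R u v"
proof
  assume "word_class S R u = word_class S R v"
  then show "word_eq S R u v"
    using word_eq.refl[OF assms, of R] by (auto simp: word_class_def intro: word_eq.sym)
qed (auto simp: word_class_def intro: word_eq.sym word_eq.trans)

lemma carrier_presented_group:
  "carrier (presented_group S R) = word_class S R ` lists (S \<times> UNIV)"
  by (simp add: presented_group_def)

lemma one_presented_group: "\<one>\<^bsub>presented_group S R\<^esub> = word_class S R []"
  by (simp add: presented_group_def)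

text \<open>The product is defined as a union over all representatives; congruence makes every
  member of that union the same class.\<close>

lemma word_class_mult:
  assumes "u \<in> lists (S \<times> UNIV)" "v \<in> lists (S \<times> UNIV)"
  shows "word_class S R u \<otimes>\<^bsub>presented_group S R\<^esub> word_class S R v = word_class S R (u @ v)"
proof -
  have eq: "word_class S R (u' @ v') = word_class S R (u @ v)"
    if "word_eq S R u u'" "word_eq S R v v'" for u' v'
    using word_eq.app[OF that] word_eq_lists(1)[OF word_eq.app[OF that]]
    by (metis word_class_eq_iff)
  have "word_eq S R u u" "word_eq S R v v"
    using assms by (auto intro: word_eq.refl)
  then have "(\<Union>u'\<in>{w. word_eq S R u w}. \<Union>v'\<in>{w. word_eq S R v w}. word_class S R (u' @ v')) =
      word_class S R (u @ v)"
    using eq by blast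
  then show ?thesis
    by (simp add: presented_group_def word_class_def[of S R u] word_class_def[of S R v])
qed

text \<open>Cancellation works from the middle outwards: the reversed word ends with the flipped
  first letter of \<open>w\<close>, which meets that letter itself and leaves the instance for the
  tail.\<close>

lemma word_eq_inverse:
  assumes "w \<in> lists (S \<times> UNIV)"
  shows "word_eq S R (map (\<lambda>(a, s). (a, \<not> s)) (rev w) @ w) []"
  using assms
proof (induction w)
  case Nil
  then show ?case by (simp add: word_eq.refl)
next
  case (Cons x w)
  obtain a s where x: "x = (a, s)" and a: "a \<in> S"
    using Cons by (cases x) auto
  let ?v = "map (\<lambda>(a, s). (a, \<not> s)) (rev w)"
  have v: "?v \<in> lists (S \<times> UNIV)" and w: "w \<in> lists (S \<times> UNIV)"
    using Cons by (auto simp: in_lists_conv_set)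
  have "word_eq S R ([(a, \<not> s), (a, s)] @ w) ([] @ w)"
    using word_eq.app[OF word_eq.cancel[OF a, of R "\<not> s"] word_eq.refl[OF w]] by simp
  then have "word_eq S R (?v @ [(a, \<not> s), (a, s)] @ w) (?v @ w)"
    using word_eq.app[OF word_eq.refl[OF v]] by simp
  then have "word_eq S R (?v @ [(a, \<not> s), (a, s)] @ w) []"
    using Cons by (auto intro: word_eq.trans)
  then show ?case
    by (simp add: x)
qed

lemma group_presented_group: "group (presented_group S R)"
proof (rule groupI)
  fix x y z
  assume "x \<in> carrier (presented_group S R)" "y \<in> carrier (presented_group S R)"
    "z \<in> carrier (presented_group S R)"
  then show "x \<otimes>\<^bsub>presented_group S R\<^esub> y \<in> carrier (presented_group S R)"
    unfolding carrier_presented_group by (elim imageE) (simp add: word_class_mult)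
next
  fix x y z
  assume "x \<in> carrier (presented_group S R)" "y \<in> carrier (presented_group S R)"
    "z \<in> carrier (presented_group S R)"
  then show "x \<otimes>\<^bsub>presented_group S R\<^esub> y \<otimes>\<^bsub>presented_group S R\<^esub> z =
      x \<otimes>\<^bsub>presented_group S R\<^esub> (y \<otimes>\<^bsub>presented_group S R\<^esub> z)"
    unfolding carrier_presented_group by (elim imageE) (simp add: word_class_mult)
next
  fix x
  assume "x \<in> carrier (presented_group S R)"
  then show "\<one>\<^bsub>presented_group S R\<^esub> \<otimes>\<^bsub>presented_group S R\<^esub> x = x"
    unfolding carrier_presented_group one_presented_group
    by (elim imageE) (simp add: word_class_mult)
next
  fix x
  assume "x \<in> carrier (presented_group S R)"
  then obtain w where w: "w \<in> lists (S \<times> UNIV)" and x: "x = word_class S R w"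
    by (auto simp: carrier_presented_group)
  let ?v = "map (\<lambda>(a, s). (a, \<not> s)) (rev w)"
  have v: "?v \<in> lists (S \<times> UNIV)"
    using w by (auto simp: in_lists_conv_set)
  have "word_class S R (?v @ w) = word_class S R []"
    using word_eq_inverse[OF w, of R] word_class_eq_iff[of "?v @ w" S R] v w by simp
  then show "\<exists>y\<in>carrier (presented_group S R). y \<otimes>\<^bsub>presented_group S R\<^esub> x = \<one>\<^bsub>presented_group S R\<^esub>"
    using v w x
    by (intro bexI[of _ "word_class S R ?v"])
      (simp_all add: carrier_presented_group one_presented_group word_class_mult)
qed (simp add: carrier_presented_group one_presented_group)

definition presented_gen ::
  "'a set \<Rightarrow> (('a \<times> bool) list \<times> ('a \<times> bool) list) set \<Rightarrow> 'a \<Rightarrow> ('a \<times> bool) list set"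
  where "presented_gen S R a = word_class S R [(a, True)]"

lemma presented_gen_closed: "a \<in> S \<Longrightarrow> presented_gen S R a \<in> carrier (presented_group S R)"
  by (simp add: carrier_presented_group presented_gen_def)

lemma generate_presented_gen:
  "generate (presented_group S R) (presented_gen S R ` S) = carrier (presented_group S R)"
    (is "generate ?G ?X = _")
proof -
  interpret G: group ?G by (rule group_presented_group)
  have X: "?X \<subseteq> carrier ?G" by (auto intro: presented_gen_closed)
  have "word_class S R w \<in> generate ?G ?X" if "w \<in> lists (S \<times> UNIV)" for w
    using that
  proof (induction w)
    case Nil
    then show ?case by (metis generate.one one_presented_group)
  next
    case (Cons x w)
    obtain a s where x: "x = (a, s)" and a: "a \<in> S" using Cons by (cases x) auto
    have "word_class S R [(a, False)] \<otimes>\<^bsub>?G\<^esub> presented_gen S R a = \<one>\<^bsub>?G\<^esub>"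
      using a word_eq.cancel[OF a, of R False] word_class_eq_iff[of _ S R]
      by (auto simp: presented_gen_def word_class_mult one_presented_group)
    then have "word_class S R [(a, False)] = inv\<^bsub>?G\<^esub> presented_gen S R a"
      using a by (intro G.inv_equality[symmetric])
        (simp_all add: presented_gen_closed, simp add: carrier_presented_group)
    then have "word_class S R [x] \<in> generate ?G ?X"
      using a x generate.incl[of _ ?X ?G] generate.inv[of _ ?X ?G]
      by (cases s) (auto simp: presented_gen_def)
    moreover have "word_class S R (x # w) = word_class S R [x] \<otimes>\<^bsub>?G\<^esub> word_class S R w"
      using Cons by (simp add: word_class_mult)
    ultimately show ?case using Cons by (simp add: generate.eng)
  qed
  then show ?thesis
    using G.generate_incl[OF X] by (auto simp: carrier_presented_group)
qed

lemma presented_group_universal: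
  fixes H (structure)
  assumes "group H" and \<phi>: "\<And>a. a \<in> S \<Longrightarrow> \<phi> a \<in> carrier H"
    and R: "\<And>u v. (u, v) \<in> R \<Longrightarrow> u \<in> lists (S \<times> UNIV) \<Longrightarrow> v \<in> lists (S \<times> UNIV) \<Longrightarrow>
      foldr (\<lambda>(a, s) y. (if s then \<phi> a else inv \<phi> a) \<otimes> y) u \<one> =
      foldr (\<lambda>(a, s) y. (if s then \<phi> a else inv \<phi> a) \<otimes> y) v \<one>"
  obtains h where "h \<in> hom (presented_group S R) H"
    and "\<And>a. a \<in> S \<Longrightarrow> h (presented_gen S R a) = \<phi> a"
proof -
  interpret H: group H by fact
  define ev where "ev = (\<lambda>w. foldr (\<lambda>(a, s) y. (if s then \<phi> a else inv \<phi> a) \<otimes> y) w \<one>)"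
  have ev_closed: "ev w \<in> carrier H" if "w \<in> lists (S \<times> UNIV)" for w
    using that by (induction w) (auto simp: ev_def \<phi>)
  have ev_append: "ev (u @ v) = ev u \<otimes> ev v"
    if "u \<in> lists (S \<times> UNIV)" "v \<in> lists (S \<times> UNIV)" for u v
    using that
  proof (induction u)
    case Nil
    then show ?case using ev_closed[of v] by (simp add: ev_def)
  next
    case (Cons x u)
    then show ?case
      using ev_closed[of u] ev_closed[of v] by (auto simp: ev_def \<phi> H.m_assoc)
  qed
  have ev_eq: "ev u = ev v" if "word_eq S R u v" for u v
    using that
  proof (induction rule: word_eq.induct)
    case (app u u' v v')
    then show ?case
      using ev_append[OF word_eq_lists(1)[OF app(1)] word_eq_lists(1)[OF app(2)]]
        ev_append[OF word_eq_lists(2)[OF app(1)] word_eq_lists(2)[OF app(2)]] by simp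
  next
    case (cancel a s)
    then show ?case by (auto simp: ev_def \<phi>)
  next
    case (rel u v)
    then show ?case using R by (simp add: ev_def)
  qed auto
  \<comment> \<open>By \<open>ev_eq\<close> evaluation is constant on classes, so an arbitrary
    representative may be chosen.\<close>
  define h where "h A = ev (SOME w. w \<in> A)" for A
  have h: "h (word_class S R w) = ev w" if "w \<in> lists (S \<times> UNIV)" for w
  proof -
    have "w \<in> word_class S R w" using that by (simp add: word_class_def word_eq.refl)
    then have "(SOME v. v \<in> word_class S R w) \<in> word_class S R w" by (rule someI)
    then show ?thesis using ev_eq unfolding h_def by (metis mem_Collect_eq word_class_def)
  qed
  show thesis
  proof
    show "h \<in> hom (presented_group S R) H"
      unfolding carrier_presented_group
      by (rule homI; unfold carrier_presented_group; elim imageE)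
        (simp_all add: h ev_closed word_class_mult ev_append)
    show "h (presented_gen S R a) = \<phi> a" if "a \<in> S" for a
      using that h[of "[(a, True)]"] by (simp add: presented_gen_def ev_def \<phi>)
  qed
qed

section \<open>Orbits of a quandle\<close>

definition quandle_orbit :: "'a set \<Rightarrow> ('a \<Rightarrow> 'a \<Rightarrow> 'a) \<Rightarrow> 'a \<Rightarrow> 'a set"
  where "quandle_orbit Q tri a = orbit (translation_group Q tri) (\<lambda>f. f) a"

lemma quandle_orbits_eq: "quandle_orbits Q tri = quandle_orbit Q tri ` Q"
  by (auto simp: quandle_orbits_def orbits_def quandle_orbit_def)

context quandle
begin

lemma tri_closed: "a \<in> Q \<Longrightarrow> b \<in> Q \<Longrightarrow> tri a b \<in> Q"
  using right_translation_bij[of b] by (auto simp: bij_betw_def)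

lemma tri_surj: "a \<in> Q \<Longrightarrow> b \<in> Q \<Longrightarrow> \<exists>a'\<in>Q. tri a' b = a"
  using right_translation_bij[of b] by (metis bij_betw_imp_surj_on imageE)

lemma translation_closed: "b \<in> Q \<Longrightarrow> (\<lambda>a\<in>Q. tri a b) \<in> carrier (BijGroup Q)"
  using right_translation_bij[of b] by (simp add: BijGroup_def Bij_def cong: bij_betw_cong)

lemma translation_subgroup:
  "subgroup (generate (BijGroup Q) {(\<lambda>a\<in>Q. tri a b) | b. b \<in> Q}) (BijGroup Q)"
  by (rule group.generate_is_subgroup[OF group_BijGroup]) (auto simp: translation_closed)

lemma translation_action: "group_action (translation_group Q tri) Q (\<lambda>f. f)"
proof -
  have "group (translation_group Q tri)"
    using subgroup.subgroup_is_group[OF translation_subgroup group_BijGroup]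
    by (simp add: translation_group_def)
  moreover have "(\<lambda>f. f) \<in> hom (translation_group Q tri) (BijGroup Q)"
    using subgroup.subset[OF translation_subgroup] by (auto simp: hom_def translation_group_def)
  ultimately show ?thesis
    by (simp add: group_action_def group_hom_def group_hom_axioms_def group_BijGroup)
qed

lemma quandle_orbit_self: "a \<in> Q \<Longrightarrow> a \<in> quandle_orbit Q tri a"
  using group_action.orbit_refl[OF translation_action] by (simp add: quandle_orbit_def)

lemma quandle_orbit_subset: "a \<in> Q \<Longrightarrow> quandle_orbit Q tri a \<subseteq> Q"
  using group_action.element_image[OF translation_action]
  by (auto simp: quandle_orbit_def orbit_def)

lemma tri_in_quandle_orbit:
  assumes "a \<in> Q" "b \<in> Q"
  shows "tri a b \<in> quandle_orbit Q tri a"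
proof -
  have "(\<lambda>a\<in>Q. tri a b) \<in> carrier (translation_group Q tri)"
    using assms by (auto simp: translation_group_def intro: generate.incl)
  then show ?thesis
    using assms
    by (auto simp: quandle_orbit_def orbit_def intro!: exI[of _ "\<lambda>a\<in>Q. tri a b"])
qed

lemma quandle_orbit_eq:
  assumes "a \<in> Q" "z \<in> quandle_orbit Q tri a"
  shows "quandle_orbit Q tri z = quandle_orbit Q tri a"
proof -
  have z: "z \<in> Q" using assms quandle_orbit_subset by blast
  then have "z \<in> quandle_orbit Q tri z \<inter> quandle_orbit Q tri a"
    using assms quandle_orbit_self by blast
  moreover have "quandle_orbit Q tri x \<in> orbits (translation_group Q tri) Q (\<lambda>f. f)" if "x \<in> Q" for x
    using that quandle_orbits_eq[of Q tri] by (simp add: quandle_orbits_def)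
  ultimately show ?thesis
    using group_action.disjoint_union[OF translation_action, of "quandle_orbit Q tri z" "quandle_orbit Q tri a"]
      assms(1) z by auto
qed

lemma quandle_orbit_tri:
  "a \<in> Q \<Longrightarrow> b \<in> Q \<Longrightarrow> quandle_orbit Q tri (tri a b) = quandle_orbit Q tri a"
  by (rule quandle_orbit_eq[OF _ tri_in_quandle_orbit])

text \<open>The translation group also contains inverses of translations, so \<open>P\<close> has to
  be invariant and not merely preserved; at an inverse the equivalence is read backwards.\<close>

lemma quandle_orbit_induct:
  assumes a: "a \<in> Q" and z: "z \<in> quandle_orbit Q tri a" and "P a"
    and P: "\<And>y b. y \<in> Q \<Longrightarrow> b \<in> Q \<Longrightarrow> P (tri y b) \<longleftrightarrow> P y"
  shows "P z"
proof -
  let ?X = "{(\<lambda>a\<in>Q. tri a b) | b. b \<in> Q}"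
  have "\<forall>x\<in>Q. P (g x) = P x" if "g \<in> generate (BijGroup Q) ?X" for g
    using that
  proof (induction rule: generate.induct)
    case one
    then show ?case by (simp add: BijGroup_def)
  next
    case (incl h)
    then show ?case using P by auto
  next
    case (inv h)
    then obtain b where b: "b \<in> Q" and h: "h = (\<lambda>a\<in>Q. tri a b)" by blast
    have Bij: "h \<in> Bij Q" using translation_closed[OF b] h by (simp add: BijGroup_def)
    have "P (inv_into Q h x) = P x" if x: "x \<in> Q" for x
    proof -
      have "inv_into Q h x \<in> Q" "h (inv_into Q h x) = x"
        using Bij x by (auto simp: Bij_def bij_betw_def inv_into_into f_inv_into_f)
      then show ?thesis using P[OF _ b, of "inv_into Q h x"] h by simp
    qed
    then show ?case by (simp add: inv_BijGroup[OF Bij])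
  next
    case (eng h1 h2)
    then have "h1 \<in> Bij Q" "h2 \<in> Bij Q"
      using subgroup.subset[OF translation_subgroup] by (auto simp: BijGroup_def)
    then show ?case
      using eng by (simp add: BijGroup_def compose_def Bij_imp_funcset[THEN funcset_mem])
  qed
  then show ?thesis
    using a z \<open>P a\<close> by (auto simp: quandle_orbit_def orbit_def translation_group_def)
qed

end

section \<open>The structure group\<close>

abbreviation structure_gen :: "'a set \<Rightarrow> ('a \<Rightarrow> 'a \<Rightarrow> 'a) \<Rightarrow> 'a \<Rightarrow> ('a \<times> bool) list set"
  where "structure_gen Q tri \<equiv> presented_gen Q
    {([(a, True), (b, True)], [(b, True), (tri a b, True)]) | a b. a \<in> Q \<and> b \<in> Q}"

lemma group_structure_group: "group (structure_group Q tri)"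
  by (simp add: structure_group_def group_presented_group)

lemma structure_gen_closed: "a \<in> Q \<Longrightarrow> structure_gen Q tri a \<in> carrier (structure_group Q tri)"
  by (simp add: structure_group_def presented_gen_closed)

lemma generate_structure_gen:
  "generate (structure_group Q tri) (structure_gen Q tri ` Q) = carrier (structure_group Q tri)"
  by (simp add: structure_group_def generate_presented_gen)

context quandle
begin

lemma structure_gen_rel:
  assumes "a \<in> Q" "b \<in> Q"
  shows "structure_gen Q tri a \<otimes>\<^bsub>structure_group Q tri\<^esub> structure_gen Q tri b =
    structure_gen Q tri b \<otimes>\<^bsub>structure_group Q tri\<^esub> structure_gen Q tri (tri a b)"
  using assms tri_closed[OF assms]
  by (auto simp: structure_group_def presented_gen_def word_class_mult word_class_eq_iff
      intro!: word_eq.rel)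

lemma structure_group_universal:
  fixes H (structure)
  assumes "group H" and "\<And>a. a \<in> Q \<Longrightarrow> \<phi> a \<in> carrier H"
    and "\<And>a b. a \<in> Q \<Longrightarrow> b \<in> Q \<Longrightarrow> \<phi> a \<otimes> \<phi> b = \<phi> b \<otimes> \<phi> (tri a b)"
  obtains h where "h \<in> hom (structure_group Q tri) H"
    and "\<And>a. a \<in> Q \<Longrightarrow> h (structure_gen Q tri a) = \<phi> a"
proof -
  interpret H: group H by fact
  let ?R = "{([(a, True), (b, True)], [(b, True), (tri a b, True)]) | a b. a \<in> Q \<and> b \<in> Q}"
  show thesis
  proof (rule presented_group_universal[where \<phi> = \<phi> and R = ?R, OF assms(1,2)])
    fix h
    assume "h \<in> hom (presented_group Q ?R) H" "\<And>a. a \<in> Q \<Longrightarrow> h (structure_gen Q tri a) = \<phi> a"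
    then show thesis by (intro that[of h]) (simp_all add: structure_group_def)
  next
    fix u v
    assume "(u, v) \<in> ?R"
    then obtain a b where ab: "a \<in> Q" "b \<in> Q"
      and uv: "u = [(a, True), (b, True)]" "v = [(b, True), (tri a b, True)]" by blast
    show "foldr (\<lambda>(a, s) y. (if s then \<phi> a else inv \<phi> a) \<otimes> y) u \<one> =
        foldr (\<lambda>(a, s) y. (if s then \<phi> a else inv \<phi> a) \<otimes> y) v \<one>"
      using assms(3)[OF ab] ab tri_closed[OF ab] by (simp add: uv assms(2))
  qed
qed

text \<open>The generators act on the quandle by the inverses of the right translations; the inverses
  are needed since products in \<open>BijGroup\<close> compose from right to left.\<close>

lemma abelian_quandle_if_comm_structure_group:
  assumes "comm_group (structure_group Q tri)"
  shows "abelian_quandle Q tri"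
proof -
  interpret B: group "BijGroup Q" by (rule group_BijGroup)
  interpret G: comm_group "structure_group Q tri" by fact
  define R where "R b = (\<lambda>a\<in>Q. tri a b)" for b
  have R: "R b \<in> carrier (BijGroup Q)" if "b \<in> Q" for b
    using translation_closed[OF that] by (simp add: R_def)
  have mult: "R a \<otimes>\<^bsub>BijGroup Q\<^esub> R b = (\<lambda>x\<in>Q. tri (tri x b) a)" if "a \<in> Q" "b \<in> Q" for a b
    using R[OF that(1)] R[OF that(2)] that
    by (auto simp: BijGroup_def compose_def R_def tri_closed)
  let ?\<phi> = "\<lambda>a. inv\<^bsub>BijGroup Q\<^esub> R a"
  obtain h where h: "h \<in> hom (structure_group Q tri) (BijGroup Q)"
    "\<And>a. a \<in> Q \<Longrightarrow> h (structure_gen Q tri a) = ?\<phi> a"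
  proof (rule structure_group_universal[where \<phi> = ?\<phi>, OF group_BijGroup])
    fix a b assume ab: "a \<in> Q" "b \<in> Q"
    \<comment> \<open>Evaluated at \<open>x\<close> this is self-distributivity, (x a) b = (x b)(a
      b). Inversion reverses both products and gives the defining relation of the structure
      group.\<close>
    have "R b \<otimes>\<^bsub>BijGroup Q\<^esub> R a = R (tri a b) \<otimes>\<^bsub>BijGroup Q\<^esub> R b"
      using ab tri_closed[OF ab] self_distrib by (auto simp: mult)
    then show "?\<phi> a \<otimes>\<^bsub>BijGroup Q\<^esub> ?\<phi> b = ?\<phi> b \<otimes>\<^bsub>BijGroup Q\<^esub> ?\<phi> (tri a b)"
      using ab tri_closed[OF ab] by (simp add: R B.inv_mult_group[symmetric])
  qed (auto simp: R)
  have "tri (tri a b) c = tri (tri a c) b" if abc: "a \<in> Q" "b \<in> Q" "c \<in> Q" for a b c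
  proof -
    have "?\<phi> b \<otimes>\<^bsub>BijGroup Q\<^esub> ?\<phi> c = ?\<phi> c \<otimes>\<^bsub>BijGroup Q\<^esub> ?\<phi> b"
      using hom_mult[OF h(1), of "structure_gen Q tri b" "structure_gen Q tri c"]
        hom_mult[OF h(1), of "structure_gen Q tri c" "structure_gen Q tri b"]
        G.m_comm[of "structure_gen Q tri b" "structure_gen Q tri c"] h(2) abc
      by (simp add: structure_gen_closed)
    then have "inv\<^bsub>BijGroup Q\<^esub> (R c \<otimes>\<^bsub>BijGroup Q\<^esub> R b) = inv\<^bsub>BijGroup Q\<^esub> (R b \<otimes>\<^bsub>BijGroup Q\<^esub> R c)"
      using abc by (simp add: R B.inv_mult_group)
    then have "R c \<otimes>\<^bsub>BijGroup Q\<^esub> R b = R b \<otimes>\<^bsub>BijGroup Q\<^esub> R c"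
      using abc R by (metis B.inv_inv B.m_closed)
    then show ?thesis
      using abc by (simp add: mult) (metis restrict_apply')
  qed
  then show ?thesis
    using quandle_axioms by (auto simp: abelian_quandle_def)
qed

text \<open>If generators commute, the common factor g_b cancels from g_a g_b = g_b g_(a b), so
  generators are constant along translations.\<close>

lemma structure_gen_orbit:
  assumes "comm_group (structure_group Q tri)" "a \<in> Q" "z \<in> quandle_orbit Q tri a"
  shows "structure_gen Q tri z = structure_gen Q tri a"
proof -
  interpret G: comm_group "structure_group Q tri" by fact
  have "structure_gen Q tri (tri y b) = structure_gen Q tri y" if "y \<in> Q" "b \<in> Q" for y b
    using structure_gen_rel[OF that] that tri_closed[OF that]
      G.m_comm[of "structure_gen Q tri y" "structure_gen Q tri b"]
    by (simp add: structure_gen_closed)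
  then show ?thesis
    using quandle_orbit_induct[OF assms(2,3), where P = "\<lambda>z. structure_gen Q tri z = structure_gen Q tri a"]
    by simp
qed

end

text \<open>Surjectivity needs only the basis, because the image is a subgroup.\<close>

lemma iso_free_Abelian_groupI:
  assumes "group G" and k: "k \<in> hom G (free_Abelian_group S)" and inj: "inj_on k (carrier G)"
    and gens: "\<And>s. s \<in> S \<Longrightarrow> frag_of s \<in> k ` carrier G"
  shows "G \<cong> free_Abelian_group S"
proof -
  interpret k: group_hom G "free_Abelian_group S" k
    using assms by (simp add: group_hom_def group_hom_axioms_def)
  have sub: "subgroup (k ` carrier G) (free_Abelian_group S)"
    by (rule k.img_is_subgroup)
  have "x \<in> k ` carrier G" if "Poly_Mapping.keys x \<subseteq> S" for x
    using that
  proof (rule free_Abelian_group_induct)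
    show "0 \<in> k ` carrier G" using subgroup.one_closed[OF sub] by simp
    show "x - y \<in> k ` carrier G"
      if "Poly_Mapping.keys x \<subseteq> S" "Poly_Mapping.keys y \<subseteq> S" "x \<in> k ` carrier G" "y \<in> k ` carrier G"
      for x y
      using subgroup.m_closed[OF sub that(3) subgroup.m_inv_closed[OF sub that(4)]] that
      by simp
  qed (rule gens)
  then have "k ` carrier G = carrier (free_Abelian_group S)"
    using k.hom_closed by (auto simp: free_Abelian_group_def)
  then show ?thesis
    using k inj by (auto simp: is_iso_def iso_def bij_betw_def)
qed

text \<open>Allows Z^3 to be compared with other free abelian groups by the cardinality of a
  basis.\<close>

lemma integer_group_triple_iso_free:
  "integer_group \<times>\<times> integer_group \<times>\<times> integer_group \<cong> free_Abelian_group {1, 2, 3 :: nat}"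
proof (rule iso_free_Abelian_groupI)
  let ?k = "\<lambda>(x, y, z). frag_cmul x (frag_of (1::nat)) + frag_cmul y (frag_of 2) +
    frag_cmul z (frag_of 3)"
  show "group (integer_group \<times>\<times> integer_group \<times>\<times> integer_group)"
    by (simp add: DirProd_group)
  have "Poly_Mapping.keys (?k (x, y, z)) \<subseteq> {1, 2, 3}" for x y z
    unfolding prod.case
    by (intro order.trans[OF keys_add] Un_least order.trans[OF keys_cmul]) simp_all
  then show "?k \<in> hom (integer_group \<times>\<times> integer_group \<times>\<times> integer_group) (free_Abelian_group {1, 2, 3})"
    by (intro homI) (auto simp: frag_cmul_distrib algebra_simps)
  have lookup: "Poly_Mapping.lookup (?k (x, y, z)) 1 = x \<and> Poly_Mapping.lookup (?k (x, y, z)) 2 = y \<and>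
      Poly_Mapping.lookup (?k (x, y, z)) 3 = z" for x y z
    by (simp add: lookup_add)
  show "inj_on ?k (carrier (integer_group \<times>\<times> integer_group \<times>\<times> integer_group))"
  proof (rule inj_onI)
    fix p q :: "int \<times> int \<times> int"
    assume "?k p = ?k q"
    then show "p = q"
      using lookup[of "fst p" "fst (snd p)" "snd (snd p)"] lookup[of "fst q" "fst (snd q)" "snd (snd q)"]
      by (simp add: prod_eq_iff)
  qed
  show "frag_of s \<in> ?k ` carrier (integer_group \<times>\<times> integer_group \<times>\<times> integer_group)"
    if "s \<in> {1, 2, 3}" for s
  proof -
    have e: "frag_of 1 = ?k (1, 0, 0)" "frag_of 2 = ?k (0, 1, 0)" "frag_of 3 = ?k (0, 0, 1)"
      by simp_all
    have mem: "?k p \<in> ?k ` carrier (integer_group \<times>\<times> integer_group \<times>\<times> integer_group)" for p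
      by (rule imageI) simp
    show ?thesis
      using that mem[of "(1, 0, 0)", folded e(1)] mem[of "(0, 1, 0)", folded e(2)]
        mem[of "(0, 0, 1)", folded e(3)]
      by (elim insertE emptyE) (simp_all only:)
  qed
qed

section \<open>Commutative structure groups are free abelian on the orbits\<close>

context quandle
begin

text \<open>The map \<open>k\<close> to the free group exists because translations preserve orbits.
  It is injective because it has a left inverse \<open>h\<close>, which sends an orbit to the
  generator of a chosen representative; by \<open>structure_gen_orbit\<close> the choice is
  immaterial, so \<open>h\<close> after \<open>k\<close> fixes every generator.\<close>

lemma structure_group_iso_free:
  assumes comm: "comm_group (structure_group Q tri)"
  shows "structure_group Q tri \<cong> free_Abelian_group (quandle_orbits Q tri)"
proof (rule quandle.structure_group_universal[OF quandle_axioms, where \<phi> = "\<lambda>a. frag_of (quandle_orbit Q tri a)"])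
  let ?F = "free_Abelian_group (quandle_orbits Q tri)" and ?G = "structure_group Q tri"
  interpret G: comm_group ?G by fact
  fix k assume k: "k \<in> hom ?G ?F"
    "\<And>a. a \<in> Q \<Longrightarrow> k (structure_gen Q tri a) = frag_of (quandle_orbit Q tri a)"
  have "(\<lambda>X. structure_gen Q tri (SOME a. a \<in> X)) ` quandle_orbits Q tri \<subseteq> carrier ?G"
  proof (clarsimp simp: quandle_orbits_eq)
    fix a
    assume a: "a \<in> Q"
    have "(SOME z. z \<in> quandle_orbit Q tri a) \<in> quandle_orbit Q tri a"
      using quandle_orbit_self[OF a] by (rule someI)
    then show "structure_gen Q tri (SOME z. z \<in> quandle_orbit Q tri a) \<in> carrier ?G"
      using quandle_orbit_subset[OF a] by (auto intro: structure_gen_closed)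
  qed
  then obtain h where h: "h \<in> hom ?F ?G"
    "\<And>X. X \<in> quandle_orbits Q tri \<Longrightarrow> h (frag_of X) = structure_gen Q tri (SOME a. a \<in> X)"
    by (rule G.free_Abelian_group_universal) (rule that)
  have hk: "h (k (structure_gen Q tri a)) = structure_gen Q tri a" if a: "a \<in> Q" for a
  proof -
    have "(SOME z. z \<in> quandle_orbit Q tri a) \<in> quandle_orbit Q tri a"
      using quandle_orbit_self[OF a] by (rule someI)
    then show ?thesis
      using a k(2) h(2) structure_gen_orbit[OF comm a] by (simp add: quandle_orbits_eq)
  qed
  interpret k: group_hom ?G ?F k
    using k by (simp add: group_hom_def group_hom_axioms_def)
  interpret h: group_hom ?F ?G h
    using h by (simp add: group_hom_def group_hom_axioms_def)
  have gens: "structure_gen Q tri ` Q \<subseteq> carrier ?G"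
    by (auto intro: structure_gen_closed)
  have "h (k x) = x" if "x \<in> generate ?G (structure_gen Q tri ` Q)" for x
    using that
  proof (induction rule: generate.induct)
    case (eng x y)
    then show ?case
      using subsetD[OF G.generate_incl[OF gens]] h.hom_mult[OF k.hom_closed k.hom_closed, of x y]
      by (simp del: mult_free_Abelian_group)
  next
    case (inv x)
    then have "x \<in> carrier ?G" using gens by blast
    moreover have "h (k x) = x" using inv hk by blast
    ultimately show ?case
      using k.hom_inv h.hom_inv[OF k.hom_closed, of x] by (simp del: inv_free_Abelian_group)
  qed (auto simp: hk simp del: one_free_Abelian_group)
  then have "inj_on k (carrier ?G)"
    by (intro inj_on_inverseI[where g = h]) (simp add: generate_structure_gen)
  moreover have "frag_of X \<in> k ` carrier ?G" if "X \<in> quandle_orbits Q tri" for X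
    using that by (auto simp: quandle_orbits_eq k(2)[symmetric] structure_gen_closed)
  ultimately show "?G \<cong> ?F"
    using k(1) by (intro iso_free_Abelian_groupI) auto
qed (auto simp: quandle_orbits_eq quandle_orbit_tri)

text \<open>An isomorphism with Z^3 forces commutativity; then both sides are free abelian, and
  invariance of rank compares the number of orbits with 3.\<close>

lemma structure_group_iso_integer_triple_iff:
  assumes "finite Q"
  shows "structure_group Q tri \<cong> integer_group \<times>\<times> integer_group \<times>\<times> integer_group \<longleftrightarrow>
    comm_group (structure_group Q tri) \<and> card (quandle_orbits Q tri) = 3"
    (is "?G \<cong> ?Z \<longleftrightarrow> _")
proof -
  have Z: "group ?Z" "comm_group ?Z"
    by (simp add: DirProd_group) (rule group.group_comm_groupI, auto simp: DirProd_group)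
  have fin: "finite (quandle_orbits Q tri)"
    using assms by (simp add: quandle_orbits_eq)
  have eqpoll: "quandle_orbits Q tri \<approx> {1, 2, 3 :: nat} \<longleftrightarrow> card (quandle_orbits Q tri) = 3"
    using fin by (simp add: eqpoll_iff_card numeral_3_eq_3)
  have "?G \<cong> ?Z \<longleftrightarrow> card (quandle_orbits Q tri) = 3" if comm: "comm_group ?G"
  proof -
    have "?G \<cong> ?Z \<longleftrightarrow> free_Abelian_group (quandle_orbits Q tri) \<cong> free_Abelian_group {1, 2, 3 :: nat}"
      using structure_group_iso_free[OF comm] integer_group_triple_iso_free
      by (meson Z(1) group.iso_sym group_free_Abelian_group group_structure_group iso_trans)
    then show ?thesis using isomorphic_free_Abelian_groups eqpoll by metis
  qed
  moreover have "comm_group ?G" if "?G \<cong> ?Z"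
    using that Z by (metis comm_group.iso_imp_comm_group group.iso_sym group_structure_group group.is_monoid)
  ultimately show ?thesis by blast
qed

end

section \<open>Coprimality of the parameters\<close>

text \<open>If only A is nontrivial modulo \<open>p\<close>, then \<open>p\<close> divides
  \<open>m1 1\<close>, \<open>m21 1\<close> (as C vanishes) and \<open>m2 2\<close> (as B vanishes).
  The other entries arise the same way: the first group of gcds from one nontrivial commutator, the
  second from two, the last from all three.\<close>

definition coprime_params :: "(nat \<Rightarrow> int) \<Rightarrow> (nat \<Rightarrow> int) \<Rightarrow> (nat \<Rightarrow> int) \<Rightarrow> bool"
  where "coprime_params m1 m21 m2 \<longleftrightarrow>
    (Gcd {m1 1, m21 1, m2 2} = 1 \<and>
     Gcd {m2 1, m1 3, m21 3} = 1 \<and>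
     Gcd {m1 2, m21 2, m2 3} = 1) \<and>
    (Gcd {m1 1, m21 1, m1 2, m2 3} = 1 \<and>
     Gcd {m1 1, m2 2, m1 3, m21 3} = 1 \<and>
     Gcd {m2 1, m1 2, m21 2, m1 3} = 1) \<and>
    Gcd {m1 1, m1 2, m1 3, m21 1 * m21 2 * m21 3 - m2 1 * m2 2 * m2 3} = 1"

text \<open>The order of \<open>x\<close> divides \<open>p\<close> and is not 1, so it is
  \<open>p\<close>.\<close>

lemma (in group) prime_dvd_if_pow_eq_one:
  assumes "x \<in> carrier G" "x \<noteq> \<one>" "prime p" "x [^] int p = \<one>" "x [^] (k :: int) = \<one>"
  shows "int p dvd k"
proof -
  have "ord x dvd p"
    using assms by (simp add: int_pow_eq_id)
  then have "ord x = p"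
    using assms prime_nat_iff by (metis ord_eq_1)
  then show ?thesis
    using assms by (simp add: int_pow_eq_id)
qed

text \<open>If \<open>n > 1\<close> is minimal with \<open>A\<^bsup>n\<^esup> = B\<^bsup>n\<^esup> = C\<^bsup>n\<^esup> = 1\<close> and \<open>p\<close> is a prime factor of \<open>n\<close>, then
  the \<open>n/p\<close>-th powers of \<open>A, B, C\<close> are killed by \<open>p\<close> and satisfy the same relations.  Which of them
  are nontrivial tells which of the seven coprimality conditions \<open>p\<close> violates.\<close>

lemma (in group) trivial_if_coprime_params:
  assumes car: "A \<in> carrier G" "B \<in> carrier G" "C \<in> carrier G"
    and pos: "m1 1 > 0" "m1 2 > 0" "m1 3 > 0"
    and A: "A [^] (m1 1 :: int) = \<one>" "A [^] (m21 1 :: int) = C [^] (m2 1 :: int)"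
    and B: "B [^] m1 2 = \<one>" "B [^] m21 2 = A [^] m2 2"
    and C: "C [^] m1 3 = \<one>" "C [^] m21 3 = B [^] m2 3"
    and cop: "coprime_params m1 m21 m2"
  shows "A = \<one>" "B = \<one>" "C = \<one>"
proof -
  define P where "P n \<longleftrightarrow> n > 0 \<and> A [^] int n = \<one> \<and> B [^] int n = \<one> \<and> C [^] int n = \<one>" for n
  define n where "n = (LEAST n. P n)"
  have mult: "x [^] (k * l) = \<one>" if "x \<in> carrier G" "x [^] k = \<one>" for x and k l :: int
    using that by (simp flip: int_pow_pow)
  \<comment> \<open>The product of the three \<open>m1\<close> is a common exponent, so a least one
    exists.\<close>
  have "P (nat (m1 1 * m1 2 * m1 3))"
    using pos mult[OF car(1) A(1), of "m1 2 * m1 3"] mult[OF car(2) B(1), of "m1 1 * m1 3"]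
      mult[OF car(3) C(1), of "m1 1 * m1 2"]
    by (simp add: P_def mult_ac)
  then have n: "P n" unfolding n_def by (rule LeastI)
  have "n = 1"
  proof (rule ccontr)
    assume "n \<noteq> 1"
    then obtain p where p: "prime p" "p dvd n" using prime_factor_nat by blast
    then obtain m where m: "n = m * p" by (metis dvdE mult.commute)
    have "0 < m" "m < n"
      using n m prime_gt_1_nat[OF p(1)] by (auto simp: P_def)
    then have "\<not> P m" unfolding n_def by (blast dest: not_less_Least)
    define A' B' C' where "A' = A [^] int m" and "B' = B [^] int m" and "C' = C [^] int m"
    have nontriv: "A' \<noteq> \<one> \<or> B' \<noteq> \<one> \<or> C' \<noteq> \<one>"
      using \<open>\<not> P m\<close> \<open>0 < m\<close> by (auto simp: P_def A'_def B'_def C'_def)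
    have car': "A' \<in> carrier G" "B' \<in> carrier G" "C' \<in> carrier G"
      using car by (auto simp: A'_def B'_def C'_def)
    \<comment> \<open>Powers of a single element commute, so each relation can be raised to the
      \<open>m\<close>-th power and read as the same relation between A', B', C'.\<close>
    have swap: "(x [^] int m) [^] k = (x [^] k) [^] int m" if "x \<in> carrier G" for x and k :: int
      using that by (simp add: int_pow_pow mult.commute)
    have p': "A' [^] int p = \<one>" "B' [^] int p = \<one>" "C' [^] int p = \<one>"
      using n car by (auto simp: P_def m A'_def B'_def C'_def int_pow_pow)
    note rel' = A'_def B'_def C'_def
    have A': "A' [^] m1 1 = \<one>" "A' [^] m21 1 = C' [^] m2 1"
      and B': "B' [^] m1 2 = \<one>" "B' [^] m21 2 = A' [^] m2 2"
      and C': "C' [^] m1 3 = \<one>" "C' [^] m21 3 = B' [^] m2 3"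
      unfolding rel' by (simp_all only: swap car A B C int_pow_one)
    note dvdA = prime_dvd_if_pow_eq_one[OF car'(1) _ p(1) p'(1)]
    note dvdB = prime_dvd_if_pow_eq_one[OF car'(2) _ p(1) p'(2)]
    note dvdC = prime_dvd_if_pow_eq_one[OF car'(3) _ p(1) p'(3)]
    \<comment> \<open>Once around the cycle A, C, B, A: each relation trades a factor
      \<open>m21 i\<close> of the exponent for \<open>m2 i\<close>.\<close>
    have "A' [^] (m21 1 * m21 2 * m21 3) = A' [^] (m2 1 * m2 2 * m2 3)"
    proof -
      have "A' [^] (m21 1 * m21 2 * m21 3) = (A' [^] m21 1) [^] (m21 2 * m21 3)"
        by (simp add: car' int_pow_pow mult_ac)
      also have "\<dots> = (C' [^] m21 3) [^] (m21 2 * m2 1)"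
        by (simp only: A'(2)) (simp add: car' int_pow_pow mult_ac)
      also have "\<dots> = (B' [^] m21 2) [^] (m2 3 * m2 1)"
        by (simp only: C'(2)) (simp add: car' int_pow_pow mult_ac)
      also have "\<dots> = A' [^] (m2 1 * m2 2 * m2 3)"
        by (simp only: B'(2)) (simp add: car' int_pow_pow mult_ac)
      finally show ?thesis .
    qed
    then have det: "A' [^] (m21 1 * m21 2 * m21 3 - m2 1 * m2 2 * m2 3) = \<one>"
      using car' by (simp add: int_pow_diff)
    have "A' \<noteq> \<one> \<Longrightarrow> int p dvd m1 1" "B' \<noteq> \<one> \<Longrightarrow> int p dvd m1 2" "C' \<noteq> \<one> \<Longrightarrow> int p dvd m1 3"
      using dvdA[OF _ A'(1)] dvdB[OF _ B'(1)] dvdC[OF _ C'(1)] by blast+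
    moreover have "A' \<noteq> \<one> \<Longrightarrow> C' = \<one> \<Longrightarrow> int p dvd m21 1" "A' = \<one> \<Longrightarrow> C' \<noteq> \<one> \<Longrightarrow> int p dvd m2 1"
      "B' \<noteq> \<one> \<Longrightarrow> A' = \<one> \<Longrightarrow> int p dvd m21 2" "B' = \<one> \<Longrightarrow> A' \<noteq> \<one> \<Longrightarrow> int p dvd m2 2"
      "C' \<noteq> \<one> \<Longrightarrow> B' = \<one> \<Longrightarrow> int p dvd m21 3" "C' = \<one> \<Longrightarrow> B' \<noteq> \<one> \<Longrightarrow> int p dvd m2 3"
      using A'(2) B'(2) C'(2) dvdA[of "m21 1"] dvdA[of "m2 2"] dvdB[of "m21 2"] dvdB[of "m2 3"]
        dvdC[of "m21 3"] dvdC[of "m2 1"] int_pow_one by metis+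
    moreover have "A' \<noteq> \<one> \<Longrightarrow> int p dvd m21 1 * m21 2 * m21 3 - m2 1 * m2 2 * m2 3"
      using dvdA det by blast
    moreover have "\<exists>x\<in>X. \<not> int p dvd x" if "Gcd X = 1" for X
    proof (rule ccontr)
      assume "\<not> (\<exists>x\<in>X. \<not> int p dvd x)"
      then have "int p dvd Gcd X" by (blast intro: Gcd_greatest)
      then show False using that prime_gt_1_nat[OF p(1)] by simp
    qed
    \<comment> \<open>Each of the seven nontrivial patterns of (A', B', C') makes \<open>p\<close>
      divide all entries of one of the seven gcds.\<close>
    ultimately show False
      using cop nontriv unfolding coprime_params_def
      by (metis (no_types, lifting) empty_iff insert_iff)
  qed
  then show "A = \<one>" "B = \<one>" "C = \<one>"
    using n car by (auto simp: P_def)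
qed

section \<open>Parameter groups\<close>

abbreviation param_coset :: "int \<Rightarrow> int \<Rightarrow> int \<Rightarrow> int \<times> int \<Rightarrow> (int \<times> int) set"
  where "param_coset m1 m21 m2 \<equiv> r_coset (integer_group \<times>\<times> integer_group) (relation_lattice m1 m21 m2)"

lemma integer_group_pair: "comm_group (integer_group \<times>\<times> integer_group)"
  by (rule group.group_comm_groupI) (auto simp: DirProd_group)

lemma generate_integer_pair:
  "generate (integer_group \<times>\<times> integer_group) {(a, 0), (b, c)} =
    {(s * a + t * b, t * c) | s t. True}"
    (is "?L = ?R")
proof -
  let ?Z = "integer_group \<times>\<times> integer_group"
  interpret Z: comm_group ?Z by (rule integer_group_pair)
  have inv: "inv\<^bsub>?Z\<^esub> (x, y) = (- x, - y)" for x y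
    by (simp add: inv_DirProd)
  have "subgroup ?R ?Z"
  proof (rule Z.subgroupI)
    fix p q
    assume "p \<in> ?R" "q \<in> ?R"
    then obtain s t s' t' where p: "p = (s * a + t * b, t * c)" and q: "q = (s' * a + t' * b, t' * c)"
      by blast
    show "inv\<^bsub>?Z\<^esub> p \<in> ?R"
      unfolding p inv by (intro CollectI exI[of _ "- s"] exI[of _ "- t"]) (simp add: algebra_simps)
    show "p \<otimes>\<^bsub>?Z\<^esub> q \<in> ?R"
      unfolding p q
      by (intro CollectI exI[of _ "s + s'"] exI[of _ "t + t'"]) (simp add: algebra_simps)
  qed auto
  moreover have "(a, 0) = (1 * a + 0 * b, 0 * c)" "(b, c) = (0 * a + 1 * b, 1 * c)"
    by simp_all
  then have "{(a, 0), (b, c)} \<subseteq> ?R"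
    by blast
  ultimately have "?L \<subseteq> ?R"
    by (simp add: Z.generate_subgroup_incl)
  moreover have "(s * a + t * b, t * c) \<in> ?L" for s t
  proof -
    have L: "subgroup ?L ?Z" by (rule Z.generate_is_subgroup) simp
    have "p [^]\<^bsub>?Z\<^esub> k = (int k * fst p, int k * snd p)" for p and k :: nat
      by (induction k) (auto simp: algebra_simps mult_DirProd')
    then have pow: "p [^]\<^bsub>?Z\<^esub> n = (n * fst p, n * snd p)" for p and n :: int
      by (cases n rule: int_cases2) (simp_all add: Z.int_pow_neg int_pow_int inv)
    have "(a, 0) \<in> ?L" "(b, c) \<in> ?L" by (auto intro: generate.incl)
    then have "(a, 0) [^]\<^bsub>?Z\<^esub> s \<otimes>\<^bsub>?Z\<^esub> (b, c) [^]\<^bsub>?Z\<^esub> t \<in> ?L"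
      using Z.subgroup_int_pow_closed[OF L] subgroup.m_closed[OF L] by blast
    then show ?thesis by (simp add: pow)
  qed
  ultimately show ?thesis by blast
qed

lemma relation_lattice_eq:
  "relation_lattice m1 m21 m2 = {(s * m1 + t * m21, t * m2) | s t. True}"
  by (simp add: relation_lattice_def generate_integer_pair)

lemma relation_lattice_normal:
  "relation_lattice m1 m21 m2 \<lhd> (integer_group \<times>\<times> integer_group)"
proof -
  interpret Z: comm_group "integer_group \<times>\<times> integer_group" by (rule integer_group_pair)
  have "subgroup (relation_lattice m1 m21 m2) (integer_group \<times>\<times> integer_group)"
    unfolding relation_lattice_def by (rule Z.generate_is_subgroup) simp
  then show ?thesis by (rule Z.subgroup_imp_normal)
qed

lemma param_coset_mult:
  "param_coset m1 m21 m2 (u, v) \<otimes>\<^bsub>param_group m1 m21 m2\<^esub> param_coset m1 m21 m2 (u', v') =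
    param_coset m1 m21 m2 (u + u', v + v')"
  using normal.rcos_sum[OF relation_lattice_normal, of "(u, v)" "(u', v')"]
  by (simp add: param_group_def FactGroup_def)

lemma carrier_param_group: "carrier (param_group m1 m21 m2) = range (param_coset m1 m21 m2)"
  by (auto simp: param_group_def FactGroup_def RCOSETS_def)

lemma param_coset_mem: "p \<in> param_coset m1 m21 m2 (u, v) \<longleftrightarrow>
    (\<exists>s t. p = (u + s * m1 + t * m21, v + t * m2))"
  by (auto simp: r_coset_def relation_lattice_eq algebra_simps) (metis add.commute)+

lemma param_coset_eqI:
  assumes "u = u' + s * m1 + t * m21" "v = v' + t * m2"
  shows "param_coset m1 m21 m2 (u, v) = param_coset m1 m21 m2 (u', v')"
proof -
  interpret Z: comm_group "integer_group \<times>\<times> integer_group" by (rule integer_group_pair)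
  have "(u, v) \<in> param_coset m1 m21 m2 (u', v')"
    using assms by (auto simp: param_coset_mem)
  then show ?thesis
    using Z.repr_independence[of _ _ "(u', v')"]
      normal_imp_subgroup[OF relation_lattice_normal] by simp
qed

lemma param_gen_eq:
  "param_gen m1 m21 m2 k = param_coset m1 m21 m2 (if k = 0 then (0, 0) else if k = 1 then (1, 0) else (0, 1))"
  by (simp add: param_gen_def)

section \<open>Commutators in the structure group of an abelian quandle\<close>

text \<open>Writing \<open>a\<close> as a' translated by \<open>c\<close>, self-distributivity pulls
  \<open>c\<close> out of both arguments, and commuting translations puts it back on a' alone. Hence
  a right translation depends only on the orbit of the translating element.\<close>

lemma (in quandle) abelian_tri_tri:
  assumes "abelian_quandle Q tri" and abc: "a \<in> Q" "b \<in> Q" "c \<in> Q"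
  shows "tri a (tri b c) = tri a b"
proof -
  obtain a' where a': "a' \<in> Q" "tri a' c = a" using tri_surj abc by blast
  have "tri (tri a' c) (tri b c) = tri (tri a' b) c"
    using self_distrib a' abc by simp
  also have "\<dots> = tri (tri a' c) b"
    using assms(1) abc a'(1) unfolding abelian_quandle_def by blast
  finally show ?thesis by (simp add: a')
qed

lemma (in quandle) abelian_tri_orbit:
  assumes ab: "abelian_quandle Q tri" and "a \<in> Q" "b \<in> Q" "z \<in> quandle_orbit Q tri b"
  shows "tri a z = tri a b"
  by (rule quandle_orbit_induct[OF assms(3,4), where P = "\<lambda>z. tri a z = tri a b"])
    (simp_all add: abelian_tri_tri[OF ab] assms)

lemma (in quandle) abelian_tri_same_orbit:
  assumes "abelian_quandle Q tri" "a \<in> Q" "b \<in> quandle_orbit Q tri a"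
  shows "tri a b = a"
  using abelian_tri_orbit[OF assms(1,2,2,3)] idem assms(2) by simp

text \<open>The centralizer of \<open>y\<close> is a subgroup.\<close>

lemma (in group) centralizer_generate:
  assumes X: "X \<subseteq> carrier G" and y: "y \<in> carrier G" and comm: "\<And>x. x \<in> X \<Longrightarrow> x \<otimes> y = y \<otimes> x"
    and "z \<in> generate G X"
  shows "z \<otimes> y = y \<otimes> z"
  using assms(4)
proof (induction rule: generate.induct)
  case (inv h)
  then have h: "h \<in> carrier G" using X by blast
  have "h \<otimes> y = y \<otimes> h" by (rule comm[OF inv])
  then show ?case
    using h y by (metis inv_closed inv_solve_left m_assoc m_closed inv_solve_right')
next
  case (eng h1 h2)
  then show ?case
    using generate_in_carrier[OF X] y by (metis m_assoc)
qed (auto simp: y comm)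

lemma (in group) comm_group_if_generators_commute:
  assumes "X \<subseteq> carrier G" "generate G X = carrier G"
    and "\<And>x y. x \<in> X \<Longrightarrow> y \<in> X \<Longrightarrow> x \<otimes> y = y \<otimes> x"
  shows "comm_group G"
proof (rule group_comm_groupI)
  fix x y
  assume xy: "x \<in> carrier G" "y \<in> carrier G"
  have "z \<otimes> x = x \<otimes> z" if "z \<in> X" for z
    using centralizer_generate[OF assms(1) _ assms(3)[symmetric]] assms that xy by (metis subsetD)
  then show "x \<otimes> y = y \<otimes> x"
    using centralizer_generate[OF assms(1) xy(1)] assms(2) xy by metis
qed

text \<open>Isolates what the commutator calculus uses: a map \<open>\<gamma>\<close> into a group
  that respects the defining relations. It is later instantiated with the structure group and its
  generators.\<close>

locale abelian_quandle_rep = quandle Q tri + group G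
  for Q :: "'a set" and tri and G :: "('b, 'c) monoid_scheme" (structure) +
  fixes \<gamma> :: "'a \<Rightarrow> 'b"
  assumes abelian: "abelian_quandle Q tri"
    and \<gamma>_closed: "a \<in> Q \<Longrightarrow> \<gamma> a \<in> carrier G"
    and \<gamma>_rel: "a \<in> Q \<Longrightarrow> b \<in> Q \<Longrightarrow> \<gamma> a \<otimes> \<gamma> b = \<gamma> b \<otimes> \<gamma> (tri a b)"
begin

text \<open>By the relation for \<open>\<gamma>\<close> this is the usual commutator of
  \<open>\<gamma> a\<close> and \<open>\<gamma> b\<close> (see \<open>commutator_eq\<close>). The
  form chosen makes it the factor by which a translation changes \<open>\<gamma> a\<close>.\<close>

definition commutator :: "'a \<Rightarrow> 'a \<Rightarrow> 'b"
  where "commutator a b = inv (\<gamma> a) \<otimes> \<gamma> (tri a b)"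

lemma commutator_closed: "a \<in> Q \<Longrightarrow> b \<in> Q \<Longrightarrow> commutator a b \<in> carrier G"
  by (simp add: commutator_def \<gamma>_closed tri_closed)

lemma \<gamma>_tri: "a \<in> Q \<Longrightarrow> b \<in> Q \<Longrightarrow> \<gamma> (tri a b) = \<gamma> a \<otimes> commutator a b"
  by (simp add: commutator_def \<gamma>_closed tri_closed flip: m_assoc)

lemma commutator_self: "a \<in> Q \<Longrightarrow> commutator a a = \<one>"
  by (simp add: commutator_def \<gamma>_closed idem)

lemma commutator_eq:
  assumes "a \<in> Q" "b \<in> Q"
  shows "commutator a b = inv (\<gamma> a) \<otimes> (inv (\<gamma> b) \<otimes> (\<gamma> a \<otimes> \<gamma> b))"
proof -
  have "\<gamma> (tri a b) = inv (\<gamma> b) \<otimes> (\<gamma> a \<otimes> \<gamma> b)"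
    using \<gamma>_rel[OF assms] assms by (simp add: \<gamma>_closed tri_closed inv_solve_left)
  then show ?thesis by (simp add: commutator_def)
qed

lemma commutator_swap: "a \<in> Q \<Longrightarrow> b \<in> Q \<Longrightarrow> commutator b a = inv (commutator a b)"
  by (simp add: commutator_eq \<gamma>_closed inv_mult_group m_assoc)

lemma commutator_tri_right:
  "a \<in> Q \<Longrightarrow> b \<in> Q \<Longrightarrow> c \<in> Q \<Longrightarrow> commutator a (tri b c) = commutator a b"
  by (simp add: commutator_def abelian_tri_tri[OF abelian])

text \<open>Reduced to the second argument by antisymmetry.\<close>

lemma commutator_tri_left:
  assumes "a \<in> Q" "b \<in> Q" "c \<in> Q"
  shows "commutator (tri a c) b = commutator a b"
  using assms commutator_tri_right[of b a c] commutator_swap[of b a] commutator_swap[of b "tri a c"]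
  by (simp add: tri_closed)

lemma commutator_orbit:
  assumes "a \<in> Q" "b \<in> Q" "z \<in> quandle_orbit Q tri a" "w \<in> quandle_orbit Q tri b"
  shows "commutator z w = commutator a b"
proof -
  have "w \<in> Q" using assms quandle_orbit_subset by blast
  have "commutator z w = commutator a w"
    by (rule quandle_orbit_induct[OF assms(1,3), where P = "\<lambda>z. commutator z w = commutator a w"])
      (simp_all add: commutator_tri_left \<open>w \<in> Q\<close>)
  also have "commutator a w = commutator a b"
    by (rule quandle_orbit_induct[OF assms(2,4), where P = "\<lambda>w. commutator a w = commutator a b"])
      (simp_all add: commutator_tri_right assms(1))
  finally show ?thesis .
qed

text \<open>The walk stays in one orbit, so every step contributes the same factor on the
  right.\<close>

lemma \<gamma>_iterate:
  assumes "a \<in> Q" "b \<in> Q" "x \<in> quandle_orbit Q tri a"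
  shows "((\<lambda>x. tri x b) ^^ n) x \<in> quandle_orbit Q tri a \<and>
    \<gamma> (((\<lambda>x. tri x b) ^^ n) x) = \<gamma> x \<otimes> commutator a b [^] n"
proof (induction n)
  case 0
  then show ?case using assms quandle_orbit_subset[of a] by (auto simp: \<gamma>_closed)
next
  case (Suc n)
  let ?y = "((\<lambda>x. tri x b) ^^ n) x"
  have y: "?y \<in> Q" "x \<in> Q" using Suc assms quandle_orbit_subset[of a] by auto
  have "tri ?y b \<in> quandle_orbit Q tri a"
    using Suc tri_in_quandle_orbit[OF y(1) assms(2)] quandle_orbit_eq[OF assms(1), of ?y] by simp
  moreover have "commutator ?y b = commutator a b"
    using commutator_orbit[OF assms(1,2) _ quandle_orbit_self[OF assms(2)]] Suc by blast
  ultimately show ?case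
    using Suc y assms \<gamma>_tri[OF y(1) assms(2)] by (simp add: m_assoc \<gamma>_closed commutator_closed)
qed

lemma comm_if_commutators_trivial:
  assumes "\<And>a b. a \<in> Q \<Longrightarrow> b \<in> Q \<Longrightarrow> commutator a b = \<one>" "generate G (\<gamma> ` Q) = carrier G"
  shows "comm_group G"
proof (rule comm_group_if_generators_commute[of "\<gamma> ` Q"])
  show "x \<otimes> y = y \<otimes> x" if "x \<in> \<gamma> ` Q" "y \<in> \<gamma> ` Q" for x y
  proof -
    obtain a b where ab: "a \<in> Q" "b \<in> Q" "x = \<gamma> a" "y = \<gamma> b"
      using \<open>x \<in> \<gamma> ` Q\<close> \<open>y \<in> \<gamma> ` Q\<close> by blast
    have "\<gamma> (tri a b) = \<gamma> a" using ab assms(1) by (simp add: \<gamma>_tri \<gamma>_closed)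
    then show ?thesis using \<gamma>_rel[OF ab(1,2)] ab by simp
  qed
qed (use assms \<gamma>_closed in auto)

end

section \<open>Coordinates on a quandle with parameters\<close>

locale parametrized_quandle = quandle Q tri
  for Q :: "'a set" and tri +
  fixes Orb :: "nat \<Rightarrow> 'a set" and m1 m21 m2 :: "nat \<Rightarrow> int" and f :: "'a \<Rightarrow> nat \<times> (int \<times> int) set"
  assumes Orb: "bij_betw Orb {1..3} (quandle_orbits Q tri)"
    and m1_pos: "i \<in> {1..3} \<Longrightarrow> 1 \<le> m1 i" and m2_pos: "i \<in> {1..3} \<Longrightarrow> 1 \<le> m2 i"
    and m21_nonneg: "i \<in> {1..3} \<Longrightarrow> 0 \<le> m21 i"
    and f: "f \<in> quandle_isos Q tri (param_carrier m1 m21 m2) (param_op m1 m21 m2)"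
    and f_Orb: "i \<in> {1..3} \<Longrightarrow> f ` Orb i = {i} \<times> carrier (param_group (m1 i) (m21 i) (m2 i))"
begin

definition base :: "nat \<Rightarrow> 'a"
  where "base i = (SOME a. a \<in> Orb i \<and> f a = (i, param_coset (m1 i) (m21 i) (m2 i) (0, 0)))"

lemma f_inj: "a \<in> Q \<Longrightarrow> b \<in> Q \<Longrightarrow> f a = f b \<Longrightarrow> a = b"
  using f by (auto simp: quandle_isos_def bij_betw_def inj_on_def)

lemma base:
  assumes "i \<in> {1..3}"
  shows "base i \<in> Q" "f (base i) = (i, param_coset (m1 i) (m21 i) (m2 i) (0, 0))"
    "Orb i = quandle_orbit Q tri (base i)"
proof -
  have "(i, param_coset (m1 i) (m21 i) (m2 i) (0, 0)) \<in> f ` Orb i"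
    by (simp add: f_Orb[OF assms] carrier_param_group)
  then obtain b where "b \<in> Orb i \<and> f b = (i, param_coset (m1 i) (m21 i) (m2 i) (0, 0))"
    by (metis imageE)
  then have *: "base i \<in> Orb i \<and> f (base i) = (i, param_coset (m1 i) (m21 i) (m2 i) (0, 0))"
    unfolding base_def by (rule someI)
  then show "f (base i) = (i, param_coset (m1 i) (m21 i) (m2 i) (0, 0))" by blast
  have "Orb i \<in> quandle_orbits Q tri" using Orb assms by (auto simp: bij_betw_def)
  then obtain a where a: "a \<in> Q" "Orb i = quandle_orbit Q tri a"
    by (auto simp: quandle_orbits_eq)
  then show "base i \<in> Q" using * quandle_orbit_subset by blast
  show "Orb i = quandle_orbit Q tri (base i)"
    using quandle_orbit_eq[OF a(1), of "base i"] * a(2) by simp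
qed

lemma orbit_cases:
  assumes "a \<in> Q"
  obtains i where "i \<in> {1..3}" "a \<in> quandle_orbit Q tri (base i)"
proof -
  have "quandle_orbit Q tri a \<in> Orb ` {1..3}"
    using Orb assms by (auto simp: bij_betw_def quandle_orbits_eq)
  then show thesis using that base(3) quandle_orbit_self[OF assms] by auto
qed

lemma f_tri:
  assumes "a \<in> Q" "b \<in> Q" "f a = (i, param_coset (m1 i) (m21 i) (m2 i) (u, v))" "f b = (j, K)"
  shows "f (tri a b) = (i, param_coset (m1 i) (m21 i) (m2 i)
    (u + (if (j + 3 - i) mod 3 = 1 then 1 else 0), v + (if (j + 3 - i) mod 3 = 2 then 1 else 0)))"
proof -
  have "f (tri a b) = param_op m1 m21 m2 (f a) (f b)"
    using f assms(1,2) by (simp add: quandle_isos_def)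
  then show ?thesis
    using mod_less_divisor[of 3 "j + 3 - i"]
    by (auto simp: assms(3,4) param_op_def param_gen_eq param_coset_mult)
qed

lemma f_iterate:
  assumes "x \<in> Q" "j \<in> {1..3}" "f x = (i, param_coset (m1 i) (m21 i) (m2 i) (u, v))"
  shows "((\<lambda>x. tri x (base j)) ^^ n) x \<in> Q \<and>
    f (((\<lambda>x. tri x (base j)) ^^ n) x) = (i, param_coset (m1 i) (m21 i) (m2 i)
      (u + (if (j + 3 - i) mod 3 = 1 then int n else 0), v + (if (j + 3 - i) mod 3 = 2 then int n else 0)))"
proof (induction n)
  case 0
  then show ?case using assms by simp
next
  case (Suc n)
  then show ?case
    using f_tri[OF _ base(1)[OF assms(2)] _ base(2)[OF assms(2)]] base(1)[OF assms(2)] tri_closed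
    by (auto simp: ac_simps)
qed

end

locale parametrized_quandle_rep = parametrized_quandle + abelian_quandle_rep
begin

text \<open>With j = i+1 and k = i+2 modulo 3, translation by \<open>base j\<close> adds 1 to the
  first coordinate in orbit i and translation by \<open>base k\<close> adds 1 to the second. Both
  generators of the lattice thus give loops at \<open>base i\<close>, and the factors collected
  along a loop multiply to 1.\<close>

lemma commutator_relations:
  assumes ijk: "i \<in> {1..3}" "j \<in> {1..3}" "k \<in> {1..3}" "(j + 3 - i) mod 3 = 1" "(k + 3 - i) mod 3 = 2"
  shows "commutator (base i) (base j) [^] m1 i = \<one>"
    and "commutator (base i) (base j) [^] m21 i = commutator (base k) (base i) [^] m2 i"
proof -
  let ?a = "base i" and ?b = "base j" and ?c = "base k"
  note Q = base(1)[OF ijk(1)] base(1)[OF ijk(2)] base(1)[OF ijk(3)]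
  note closed = commutator_closed[OF Q(1,2)] commutator_closed[OF Q(1,3)] \<gamma>_closed[OF Q(1)]
  note self = quandle_orbit_self[OF Q(1)]
  let ?x = "\<lambda>n. ((\<lambda>x. tri x ?b) ^^ n) ?a"
  have x: "?x n \<in> Q" "f (?x n) = (i, param_coset (m1 i) (m21 i) (m2 i) (int n, 0))" for n
    using f_iterate[OF Q(1) ijk(2) base(2)[OF ijk(1)], of n] ijk by auto
  have "f (?x (nat (m1 i))) = f ?a"
    using m1_pos[OF ijk(1)] base(2)[OF ijk(1)]
    by (simp add: x param_coset_eqI[where s = 1 and t = 0])
  then have "?x (nat (m1 i)) = ?a" using f_inj x Q by blast
  then have "commutator ?a ?b [^] nat (m1 i) = \<one>"
    using \<gamma>_iterate[OF Q(1,2) self, of "nat (m1 i)"] closed by auto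
  then show "commutator ?a ?b [^] m1 i = \<one>"
    using m1_pos[OF ijk(1)] int_pow_int[of G "commutator ?a ?b" "nat (m1 i)"] by simp
  \<comment> \<open>The loop for the lattice generator \<open>(m21 i, m2 i)\<close>: its first leg
    along \<open>base j\<close>, its second along \<open>base k\<close>.\<close>
  let ?y = "((\<lambda>x. tri x ?c) ^^ nat (m2 i)) (?x (nat (m21 i)))"
  have "0 \<le> m21 i" "0 \<le> m2 i"
    using m21_nonneg[OF ijk(1)] m2_pos[OF ijk(1)] by simp_all
  then have y: "?y \<in> Q" "f ?y = (i, param_coset (m1 i) (m21 i) (m2 i) (m21 i, m2 i))"
    using f_iterate[OF x(1) ijk(3) x(2), of "nat (m2 i)"] ijk by simp_all
  have "f ?y = f ?a"
    unfolding y(2) base(2)[OF ijk(1)] by (simp add: param_coset_eqI[where s = 0 and t = 1])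
  then have "?y = ?a" using f_inj y Q by blast
  then have "\<gamma> ?a = \<gamma> ?a \<otimes> commutator ?a ?b [^] nat (m21 i) \<otimes> commutator ?a ?c [^] nat (m2 i)"
    using \<gamma>_iterate[OF Q(1,2) self, of "nat (m21 i)"]
      \<gamma>_iterate[OF Q(1,3), of "?x (nat (m21 i))" "nat (m2 i)"] by simp
  then have "commutator ?a ?b [^] nat (m21 i) \<otimes> commutator ?a ?c [^] nat (m2 i) = \<one>"
    using closed by (simp add: m_assoc)
  then have "commutator ?a ?b [^] m21 i \<otimes> commutator ?a ?c [^] m2 i = \<one>"
    using m21_nonneg[OF ijk(1)] m2_pos[OF ijk(1)]
      int_pow_int[of G "commutator ?a ?b" "nat (m21 i)"] int_pow_int[of G "commutator ?a ?c" "nat (m2 i)"]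
    by simp
  then have "commutator ?a ?b [^] m21 i = inv (commutator ?a ?c [^] m2 i)"
    using closed by (simp add: inv_equality)
  also have "\<dots> = commutator ?c ?a [^] m2 i"
    using Q closed by (simp add: commutator_swap[of ?a ?c] int_pow_inv)
  finally show "commutator ?a ?b [^] m21 i = commutator ?c ?a [^] m2 i" .
qed

lemma comm_group_if_coprime_params:
  assumes cop: "coprime_params m1 m21 m2" and gen: "generate G (\<gamma> ` Q) = carrier G"
  shows "comm_group G"
proof -
  have I: "(1::nat) \<in> {1..3}" "(2::nat) \<in> {1..3}" "(3::nat) \<in> {1..3}" by auto
  note Q = base(1)[OF I(1)] base(1)[OF I(2)] base(1)[OF I(3)]
  have r1: "commutator (base 1) (base 2) [^] m1 1 = \<one>"
      "commutator (base 1) (base 2) [^] m21 1 = commutator (base 3) (base 1) [^] m2 1"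
    and r2: "commutator (base 2) (base 3) [^] m1 2 = \<one>"
      "commutator (base 2) (base 3) [^] m21 2 = commutator (base 1) (base 2) [^] m2 2"
    and r3: "commutator (base 3) (base 1) [^] m1 3 = \<one>"
      "commutator (base 3) (base 1) [^] m21 3 = commutator (base 2) (base 3) [^] m2 3"
    using commutator_relations[of 1 2 3] commutator_relations[of 2 3 1] commutator_relations[of 3 1 2]
    by simp_all
  have pos: "m1 1 > 0" "m1 2 > 0" "m1 3 > 0"
    using m1_pos[OF I(1)] m1_pos[OF I(2)] m1_pos[OF I(3)] by simp_all
  note triv = trivial_if_coprime_params[OF commutator_closed[OF Q(1,2)] commutator_closed[OF Q(2,3)]
      commutator_closed[OF Q(3,1)] pos r1 r2 r3 cop]
  \<comment> \<open>Of the nine pairs three are diagonal, three are the cyclic ones just shown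
    trivial, and three are their inverses.\<close>
  have basis: "commutator (base i) (base j) = \<one>" if "i \<in> {1..3}" "j \<in> {1..3}" for i j
  proof -
    have "i = 1 \<or> i = 2 \<or> i = 3" "j = 1 \<or> j = 2 \<or> j = 3" using that by auto
    then show ?thesis
      using triv Q commutator_swap[of "base 1" "base 2"] commutator_swap[of "base 2" "base 3"]
        commutator_swap[of "base 3" "base 1"]
      by (elim disjE) (simp_all add: commutator_self)
  qed
  have "commutator a b = \<one>" if ab: "a \<in> Q" "b \<in> Q" for a b
  proof -
    obtain i where i: "i \<in> {1..3}" "a \<in> quandle_orbit Q tri (base i)" using orbit_cases[OF ab(1)] .
    obtain j where j: "j \<in> {1..3}" "b \<in> quandle_orbit Q tri (base j)" using orbit_cases[OF ab(2)] .
    show ?thesis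
      using commutator_orbit[OF base(1)[OF i(1)] base(1)[OF j(1)] i(2) j(2)] basis[OF i(1) j(1)]
      by simp
  qed
  then show ?thesis using gen by (rule comm_if_commutators_trivial)
qed

end

section \<open>Necessity of the coprimality conditions\<close>

text \<open>The hypothesis is applied to \<open>p = Gcd X\<close>, which the nonzero member makes
  positive.\<close>

lemma Gcd_int_eq_oneI:
  fixes X :: "int set"
  assumes "x \<in> X" "x \<noteq> 0" "\<And>p. p > 0 \<Longrightarrow> (\<And>x. x \<in> X \<Longrightarrow> p dvd x) \<Longrightarrow> p dvd 1"
  shows "Gcd X = 1"
proof -
  have "Gcd X \<noteq> 0" using assms(1,2) by (auto simp: Gcd_0_iff)
  moreover have "Gcd X \<ge> 0" by simp
  ultimately have "Gcd X > 0" by linarith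
  then have "Gcd X dvd 1" using assms(3) by (blast intro: Gcd_dvd)
  then show ?thesis using \<open>Gcd X > 0\<close> by simp
qed

text \<open>For the last condition, the columns of the adjugate of the matrix of the relations between
  \<open>A, B, C\<close> are solutions modulo \<open>p\<close>; so all \<open>2 \<times> 2\<close> minors vanish modulo \<open>p\<close>, and the cross product
  of a row with any vector is again a solution.\<close>

lemma coprime_paramsI:
  assumes pos: "\<And>i. i \<in> {1..3} \<Longrightarrow> m1 i \<noteq> 0" "\<And>i. i \<in> {1..3} \<Longrightarrow> m2 i \<noteq> 0"
    and sol: "\<And>p A B C. p > 0 \<Longrightarrow> p dvd m1 1 * A \<Longrightarrow> p dvd m1 2 * B \<Longrightarrow> p dvd m1 3 * C \<Longrightarrow>
      p dvd m21 1 * A - m2 1 * C \<Longrightarrow> p dvd m21 2 * B - m2 2 * A \<Longrightarrow> p dvd m21 3 * C - m2 3 * B \<Longrightarrow>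
      p dvd A \<and> p dvd B \<and> p dvd C"
  shows "coprime_params m1 m21 m2"
proof -
  have I: "(1::nat) \<in> {1..3}" "(2::nat) \<in> {1..3}" "(3::nat) \<in> {1..3}" by auto
  note m1 = pos(1)[OF I(1)] pos(1)[OF I(2)] pos(1)[OF I(3)]
  \<comment> \<open>The next three conditions come from unit vectors, the solutions with a single
    nonzero entry.\<close>
  have c11: "p dvd 1" if "p > 0" "p dvd m1 1" "p dvd m21 1" "p dvd m2 2" for p
    using sol[of p 1 0 0] that by simp
  have c12: "p dvd 1" if "p > 0" "p dvd m2 1" "p dvd m1 3" "p dvd m21 3" for p
    using sol[of p 0 0 1] that by simp
  have c13: "p dvd 1" if "p > 0" "p dvd m1 2" "p dvd m21 2" "p dvd m2 3" for p
    using sol[of p 0 1 0] that by simp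
  have c21: "p dvd 1" if "p > 0" "p dvd m1 1" "p dvd m21 1" "p dvd m1 2" "p dvd m2 3" for p
  proof -
    \<comment> \<open>The vector (\<open>m21 2\<close>, \<open>m2 2\<close>, 0) satisfies the only
      relation between A and B identically; the hypotheses on \<open>p\<close> take care of the
      others. The next two conditions use its cyclic analogues.\<close>
    have "p dvd m21 2 \<and> p dvd m2 2 \<and> p dvd 0"
      by (rule sol) (use that in \<open>simp_all add: mult.commute[of "m21 2"] dvd_mult2\<close>)
    then show ?thesis using c11 that by blast
  qed
  have c22: "p dvd 1" if "p > 0" "p dvd m1 1" "p dvd m2 2" "p dvd m1 3" "p dvd m21 3" for p
  proof -
    have "p dvd m2 1 \<and> p dvd 0 \<and> p dvd m21 1"
      by (rule sol) (use that in \<open>simp_all add: mult.commute[of "m21 1"] dvd_mult2\<close>)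
    then show ?thesis using c11 that by blast
  qed
  have c23: "p dvd 1" if "p > 0" "p dvd m2 1" "p dvd m1 2" "p dvd m21 2" "p dvd m1 3" for p
  proof -
    have "p dvd 0 \<and> p dvd m21 3 \<and> p dvd m2 3"
      by (rule sol) (use that in \<open>simp_all add: mult.commute[of "m21 3"] dvd_mult2\<close>)
    then show ?thesis using c13 that by blast
  qed
  have c3: "p dvd 1" if p: "p > 0" "p dvd m1 1" "p dvd m1 2" "p dvd m1 3"
    "p dvd m21 1 * m21 2 * m21 3 - m2 1 * m2 2 * m2 3" for p
  proof -
    let ?d = "m21 1 * m21 2 * m21 3 - m2 1 * m2 2 * m2 3"
    \<comment> \<open>A column of the adjugate: the first relation becomes the determinant, the
      other two vanish identically. The next two columns are cyclic shifts.\<close>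
    have col1: "p dvd m21 2 * m21 3 \<and> p dvd m2 2 * m21 3 \<and> p dvd m2 2 * m2 3"
    proof (rule sol)
      have "m21 1 * (m21 2 * m21 3) - m2 1 * (m2 2 * m2 3) = ?d" by (simp add: algebra_simps)
      then show "p dvd m21 1 * (m21 2 * m21 3) - m2 1 * (m2 2 * m2 3)" by (simp only: p(5))
    qed (use p in \<open>simp_all add: dvd_mult2\<close>)
    have col2: "p dvd m2 3 * m2 1 \<and> p dvd m21 3 * m21 1 \<and> p dvd m2 3 * m21 1"
    proof (rule sol)
      have "m21 2 * (m21 3 * m21 1) - m2 2 * (m2 3 * m2 1) = ?d" by (simp add: algebra_simps)
      then show "p dvd m21 2 * (m21 3 * m21 1) - m2 2 * (m2 3 * m2 1)" by (simp only: p(5))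
    qed (use p in \<open>simp_all add: dvd_mult2\<close>)
    have col3: "p dvd m2 1 * m21 2 \<and> p dvd m2 1 * m2 2 \<and> p dvd m21 1 * m21 2"
    proof (rule sol)
      have "m21 3 * (m21 1 * m21 2) - m2 3 * (m2 1 * m2 2) = ?d" by (simp add: algebra_simps)
      then show "p dvd m21 3 * (m21 1 * m21 2) - m2 3 * (m2 1 * m2 2)" by (simp only: p(5))
    qed (use p in \<open>simp_all add: dvd_mult2\<close>)
    \<comment> \<open>Cross product of the first row with the second unit vector; below, of the
      second row with the third. They yield \<open>p dvd m21 1\<close> and
      \<open>p dvd m2 2\<close>, so \<open>c11\<close> applies.\<close>
    have "p dvd m2 1 \<and> p dvd 0 \<and> p dvd m21 1"
      by (rule sol) (use p col1 col2 col3 in \<open>simp_all add: dvd_mult2 mult.commute\<close>)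
    moreover have "p dvd m21 2 \<and> p dvd m2 2 \<and> p dvd 0"
      by (rule sol) (use p col1 col2 col3 in \<open>simp_all add: dvd_mult2 mult.commute\<close>)
    ultimately show ?thesis using c11 p by blast
  qed
  show ?thesis
    unfolding coprime_params_def
  proof (intro conjI)
    show "Gcd {m1 1, m21 1, m2 2} = 1"
      by (rule Gcd_int_eq_oneI[OF _ m1(1)], blast, rule c11; blast)
    show "Gcd {m2 1, m1 3, m21 3} = 1"
      by (rule Gcd_int_eq_oneI[OF _ m1(3)], blast, rule c12; blast)
    show "Gcd {m1 2, m21 2, m2 3} = 1"
      by (rule Gcd_int_eq_oneI[OF _ m1(2)], blast, rule c13; blast)
    show "Gcd {m1 1, m21 1, m1 2, m2 3} = 1"
      by (rule Gcd_int_eq_oneI[OF _ m1(1)], blast, rule c21; blast)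
    show "Gcd {m1 1, m2 2, m1 3, m21 3} = 1"
      by (rule Gcd_int_eq_oneI[OF _ m1(1)], blast, rule c22; blast)
    show "Gcd {m2 1, m1 2, m21 2, m1 3} = 1"
      by (rule Gcd_int_eq_oneI[OF _ m1(2)], blast, rule c23; blast)
    show "Gcd {m1 1, m1 2, m1 3, m21 1 * m21 2 * m21 3 - m2 1 * m2 2 * m2 3} = 1"
      by (rule Gcd_int_eq_oneI[OF _ m1(1)], blast, rule c3; blast)
  qed
qed

text \<open>The central extension of Z^3 by Z/p with a bilinear cocycle. The cocycle is deliberately
  not symmetric: it is A on (e1, e2) and 0 on (e2, e1), and likewise cyclically, so the standard
  lifts have commutators A, B, C.\<close>

definition heisenberg :: "int \<Rightarrow> int \<Rightarrow> int \<Rightarrow> int \<Rightarrow> (int \<times> int \<times> int \<times> int) monoid"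
  where "heisenberg p A B C =
    \<lparr>carrier = UNIV \<times> UNIV \<times> UNIV \<times> {0..<p},
     monoid.mult = (\<lambda>(x1, x2, x3, z) (y1, y2, y3, w).
       (x1 + y1, x2 + y2, x3 + y3, (z + w + A * x1 * y2 + B * x2 * y3 + C * x3 * y1) mod p)),
     one = (0, 0, 0, 0)\<rparr>"

lemma heisenberg_mult_mod:
  "(x1, x2, x3, z mod p) \<otimes>\<^bsub>heisenberg p A B C\<^esub> (y1, y2, y3, w mod p) =
    (x1 + y1, x2 + y2, x3 + y3, (z + w + A * x1 * y2 + B * x2 * y3 + C * x3 * y1) mod p)"
proof -
  have "p dvd (z mod p - z) + (w mod p - w)"
    by (intro dvd_add) (simp_all flip: mod_eq_dvd_iff)
  then show ?thesis
    by (simp add: heisenberg_def mod_eq_dvd_iff algebra_simps)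
qed

lemma group_heisenberg:
  assumes "p > 0"
  shows "group (heisenberg p A B C)"
proof (rule groupI)
  fix x
  assume "x \<in> carrier (heisenberg p A B C)"
  obtain x1 x2 x3 z where x: "x = (x1, x2, x3, z)" by (cases x)
  \<comment> \<open>The cocycle takes the value \<open>- ?c\<close> on (-x, x), so the inverse has
    last coordinate \<open>?c - z\<close>.\<close>
  let ?c = "A * x1 * x2 + B * x2 * x3 + C * x3 * x1"
  let ?y = "(- x1, - x2, - x3, (?c - z) mod p)"
  have "((?c - z) mod p + (z - ?c)) mod p = 0"
    by (simp add: mod_add_left_eq)
  moreover have "(?c - z) mod p + z + A * - x1 * x2 + B * - x2 * x3 + C * - x3 * x1 =
      (?c - z) mod p + (z - ?c)" by simp
  ultimately have "((?c - z) mod p + z + A * - x1 * x2 + B * - x2 * x3 + C * - x3 * x1) mod p = 0"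
    by (simp only:)
  then have "?y \<otimes>\<^bsub>heisenberg p A B C\<^esub> x = \<one>\<^bsub>heisenberg p A B C\<^esub>"
    by (simp add: heisenberg_def x)
  moreover have "?y \<in> carrier (heisenberg p A B C)"
    using assms by (simp add: heisenberg_def)
  ultimately show "\<exists>y\<in>carrier (heisenberg p A B C).
      y \<otimes>\<^bsub>heisenberg p A B C\<^esub> x = \<one>\<^bsub>heisenberg p A B C\<^esub>" by blast
next
  fix x y z
  have left: "(t mod p + s + a + b + c) mod p = (t + s + a + b + c) mod p"
    and right: "(s + t mod p + a + b + c) mod p = (s + t + a + b + c) mod p" for s t a b c
  proof -
    have "p dvd t mod p - t" by (simp flip: mod_eq_dvd_iff)
    moreover have "t mod p + s + a + b + c - (t + s + a + b + c) = t mod p - t"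
      "s + t mod p + a + b + c - (s + t + a + b + c) = t mod p - t" by simp_all
    ultimately show "(t mod p + s + a + b + c) mod p = (t + s + a + b + c) mod p"
      "(s + t mod p + a + b + c) mod p = (s + t + a + b + c) mod p"
      by (simp_all only: mod_eq_dvd_iff)
  qed
  show "x \<otimes>\<^bsub>heisenberg p A B C\<^esub> y \<otimes>\<^bsub>heisenberg p A B C\<^esub> z =
      x \<otimes>\<^bsub>heisenberg p A B C\<^esub> (y \<otimes>\<^bsub>heisenberg p A B C\<^esub> z)"
    by (cases x; cases y; cases z)
      (simp add: heisenberg_def left right, simp add: algebra_simps)
qed (use assms in \<open>auto simp: heisenberg_def\<close>)

section \<open>Homomorphisms from the structure group to the central extension\<close>

context parametrized_quandle
begin

lemma f_cases:
  assumes "a \<in> Q"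
  obtains i u v where "i \<in> {1..3}" "f a = (i, param_coset (m1 i) (m21 i) (m2 i) (u, v))"
proof -
  have "f a \<in> param_carrier m1 m21 m2"
    using f assms by (auto simp: quandle_isos_def bij_betw_def)
  then show thesis
    using that by (auto simp: param_carrier_def carrier_param_group)
qed

text \<open>Orbit i is sent to the fibre over the i-th unit vector, the central coordinate being
  linear in the orbit coordinates. If the structure group is commutative, the images of the base
  points commute, which kills their commutators A, B, C modulo \<open>p\<close>.\<close>

lemma dvd_if_comm_structure_group:
  assumes comm: "comm_group (structure_group Q tri)" and p: "p > 0"
    and A: "p dvd m1 1 * A" "p dvd m21 1 * A - m2 1 * C"
    and B: "p dvd m1 2 * B" "p dvd m21 2 * B - m2 2 * A"
    and C: "p dvd m1 3 * C" "p dvd m21 3 * C - m2 3 * B"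
  shows "p dvd A \<and> p dvd B \<and> p dvd C"
proof -
  let ?H = "heisenberg p A B C"
  \<comment> \<open>\<open>\<alpha> i\<close> is the intended commutator of orbit i with orbit i+1
    and \<open>\<beta> i\<close> that with orbit i+2; the latter runs against the cyclic order,
    hence the signs.\<close>
  define \<alpha> where "\<alpha> i = (if i = 1 then A else if i = 2 then B else C)" for i :: nat
  define \<beta> where "\<beta> i = (if i = 1 then - C else if i = 2 then - A else - B)" for i :: nat
  \<comment> \<open>Independent of the chosen representative, since by \<open>rel\<close> the linear
    form vanishes modulo \<open>p\<close> on the relation lattice.\<close>
  define \<zeta> where "\<zeta> i K = (case SOME x. x \<in> K of (u, v) \<Rightarrow> (\<alpha> i * u + \<beta> i * v) mod p)"
    for i and K :: "(int \<times> int) set"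
  define emb :: "nat \<Rightarrow> int \<Rightarrow> int \<times> int \<times> int \<times> int" where
    "emb i z = (if i = 1 then (1, 0, 0, z) else if i = 2 then (0, 1, 0, z) else (0, 0, 1, z))" for i z
  define \<phi> where "\<phi> a = (case f a of (i, K) \<Rightarrow> emb i (\<zeta> i K))" for a
  have rel: "p dvd m1 i * \<alpha> i" "p dvd m21 i * \<alpha> i + m2 i * \<beta> i" if "i \<in> {1..3}" for i
  proof -
    have "i = 1 \<or> i = 2 \<or> i = 3" using that by auto
    then show "p dvd m1 i * \<alpha> i" "p dvd m21 i * \<alpha> i + m2 i * \<beta> i"
      using A B C by (auto simp: \<alpha>_def \<beta>_def)
  qed
  have \<zeta>: "\<zeta> i (param_coset (m1 i) (m21 i) (m2 i) (u, v)) = (\<alpha> i * u + \<beta> i * v) mod p"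
    if i: "i \<in> {1..3}" for i u v
  proof -
    let ?K = "param_coset (m1 i) (m21 i) (m2 i) (u, v)"
    have "(u, v) = (u + 0 * m1 i + 0 * m21 i, v + 0 * m2 i)" by simp
    then have "(u, v) \<in> ?K" unfolding param_coset_mem by blast
    then have "(SOME x. x \<in> ?K) \<in> ?K" by (rule someI)
    then obtain s t where st: "(SOME x. x \<in> ?K) = (u + s * m1 i + t * m21 i, v + t * m2 i)"
      by (auto simp: param_coset_mem)
    have "\<alpha> i * (u + s * m1 i + t * m21 i) + \<beta> i * (v + t * m2 i) - (\<alpha> i * u + \<beta> i * v) =
        s * (m1 i * \<alpha> i) + t * (m21 i * \<alpha> i + m2 i * \<beta> i)"
      by (simp add: algebra_simps)
    also have "p dvd \<dots>"
      by (rule dvd_add[OF dvd_mult[OF rel(1)[OF i]] dvd_mult[OF rel(2)[OF i]]])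
    finally show ?thesis
      by (simp only: \<zeta>_def st prod.case mod_eq_dvd_iff)
  qed
  have \<phi>: "\<phi> a = emb i ((\<alpha> i * u + \<beta> i * v) mod p)"
    if "i \<in> {1..3}" "f a = (i, param_coset (m1 i) (m21 i) (m2 i) (u, v))" for a i u v
    using that by (simp add: \<phi>_def \<zeta>)
  obtain h where h: "h \<in> hom (structure_group Q tri) ?H"
    "\<And>a. a \<in> Q \<Longrightarrow> h (structure_gen Q tri a) = \<phi> a"
  proof (rule structure_group_universal[where \<phi> = \<phi>, OF group_heisenberg[OF p, of A B C]])
    show "\<phi> a \<in> carrier ?H" if a: "a \<in> Q" for a
    proof -
      obtain i u v where "i \<in> {1..3}" "f a = (i, param_coset (m1 i) (m21 i) (m2 i) (u, v))"
        using f_cases[OF a] .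
      then show ?thesis using p by (simp add: \<phi> emb_def heisenberg_def)
    qed
    show "\<phi> a \<otimes>\<^bsub>?H\<^esub> \<phi> b = \<phi> b \<otimes>\<^bsub>?H\<^esub> \<phi> (tri a b)" if ab: "a \<in> Q" "b \<in> Q" for a b
    proof -
      obtain i u v where i: "i \<in> {1..3}" and a: "f a = (i, param_coset (m1 i) (m21 i) (m2 i) (u, v))"
        using f_cases[OF ab(1)] .
      obtain j u' v' where j: "j \<in> {1..3}" and b: "f b = (j, param_coset (m1 j) (m21 j) (m2 j) (u', v'))"
        using f_cases[OF ab(2)] .
      \<comment> \<open>In each of the nine cases the two cocycle values differ by exactly the
        increment that \<open>tri\<close> causes in the linear form.\<close>
      have "i = 1 \<or> i = 2 \<or> i = 3" "j = 1 \<or> j = 2 \<or> j = 3" using i j by auto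
      then show ?thesis
        unfolding \<phi>[OF i a] \<phi>[OF j b] \<phi>[OF i f_tri[OF ab a b]]
        by (elim disjE; simp add: emb_def \<alpha>_def \<beta>_def heisenberg_mult_mod; simp add: algebra_simps)
    qed
  qed (rule that)
  have comm_\<phi>: "\<phi> (base i) \<otimes>\<^bsub>?H\<^esub> \<phi> (base j) = \<phi> (base j) \<otimes>\<^bsub>?H\<^esub> \<phi> (base i)"
    if ij: "i \<in> {1..3}" "j \<in> {1..3}" for i j
  proof -
    note gen = structure_gen_closed[OF base(1)[OF ij(1)], of tri] structure_gen_closed[OF base(1)[OF ij(2)], of tri]
    show ?thesis
      using comm_monoid.m_comm[OF comm_group.axioms(1)[OF comm] gen]
        hom_mult[OF h(1) gen] hom_mult[OF h(1) gen(2,1)]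
      by (simp add: h(2)[OF base(1)[OF ij(1)]] h(2)[OF base(1)[OF ij(2)]])
  qed
  have \<phi>_base: "\<phi> (base i) = emb i 0" if "i \<in> {1..3}" for i
    using \<phi>[OF that base(2)[OF that]] by simp
  show ?thesis
    using comm_\<phi>[of 1 2] comm_\<phi>[of 2 3] comm_\<phi>[of 3 1] p
    by (simp add: \<phi>_base emb_def heisenberg_def mod_eq_0_iff_dvd)
qed

lemma coprime_params_if_comm_structure_group:
  assumes "comm_group (structure_group Q tri)"
  shows "coprime_params m1 m21 m2"
proof (rule coprime_paramsI)
  show "m1 i \<noteq> 0" if "i \<in> {1..3}" for i using m1_pos[OF that] by simp
  show "m2 i \<noteq> 0" if "i \<in> {1..3}" for i using m2_pos[OF that] by simp
qed (rule dvd_if_comm_structure_group[OF assms])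

end

section \<open>Existence of parameters\<close>

text \<open>Hermite normal form: \<open>m2\<close> is the least positive second coordinate,
  \<open>m1\<close> the least positive first coordinate on the axis, and \<open>m21\<close> is
  reduced modulo \<open>m1\<close>. The vectors (n, 0) and (0, n) guarantee that both minima exist;
  division with remainder gives generation.\<close>

lemma relation_lattice_basis:
  assumes L: "subgroup L (integer_group \<times>\<times> integer_group)"
    and n: "n > 0" "(n, 0) \<in> L" "(0, n) \<in> L"
  obtains m1 m21 m2 where "1 \<le> m1" "1 \<le> m2" "0 \<le> m21" "m21 < m1" "L = relation_lattice m1 m21 m2"
proof -
  let ?Z = "integer_group \<times>\<times> integer_group"
  interpret Z: comm_group ?Z by (rule integer_group_pair)
  have add: "(x + x', y + y') \<in> L" if "(x, y) \<in> L" "(x', y') \<in> L" for x x' y y'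
    using subgroup.m_closed[OF L that] by simp
  have neg: "(- x, - y) \<in> L" if "(x, y) \<in> L" for x y
    using subgroup.m_inv_closed[OF L that] by simp
  have natmul: "(int k * x, int k * y) \<in> L" if "(x, y) \<in> L" for k x y
  proof (induction k)
    case 0
    then show ?case using subgroup.one_closed[OF L] by simp
  next
    case (Suc k)
    then show ?case using add[OF that Suc] by (simp add: algebra_simps)
  qed
  have mul: "(k * x, k * y) \<in> L" if "(x, y) \<in> L" for k x y
    using natmul[OF that] neg[OF natmul[OF that]] by (cases k rule: int_cases2) auto
  have sub: "(x - k * x', y - k * y') \<in> L" if "(x, y) \<in> L" "(x', y') \<in> L" for k x x' y y'
    using add[OF that(1) neg[OF mul[OF that(2), of k]]] by simp
  define P where "P k \<longleftrightarrow> k > 0 \<and> (\<exists>u. (u, int k) \<in> L)" for k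
  define R where "R k \<longleftrightarrow> k > 0 \<and> (int k, 0) \<in> L" for k
  have "P (nat n)" "R (nat n)" using n by (auto simp: P_def R_def)
  then have "P (LEAST k. P k)" "R (LEAST k. R k)" by (simp_all only: LeastI)
  define m1 where "m1 = int (LEAST k. R k)"
  define m2 where "m2 = int (LEAST k. P k)"
  obtain w where m2: "m2 > 0" "(w, m2) \<in> L" and m1: "m1 > 0" "(m1, 0) \<in> L"
    using \<open>P (LEAST k. P k)\<close> \<open>R (LEAST k. R k)\<close> by (auto simp: P_def R_def m1_def m2_def)
  have m2_min: "v = 0" if "(u, v) \<in> L" "0 \<le> v" "v < m2" for u v
  proof (rule ccontr)
    assume "v \<noteq> 0"
    then have "P (nat v)" using that by (auto simp: P_def)
    then have "m2 \<le> v" using that Least_le[of P "nat v"] by (simp add: m2_def)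
    then show False using that by simp
  qed
  have m1_min: "u = 0" if "(u, 0) \<in> L" "0 \<le> u" "u < m1" for u
  proof (rule ccontr)
    assume "u \<noteq> 0"
    then have "R (nat u)" using that by (auto simp: R_def)
    then have "m1 \<le> u" using that Least_le[of R "nat u"] by (simp add: m1_def)
    then show False using that by simp
  qed
  define m21 where "m21 = w mod m1"
  have m21: "(m21, m2) \<in> L"
    using sub[OF m2(2) m1(2), of "w div m1"]
    by (simp add: m21_def minus_div_mult_eq_mod)
  have "L = relation_lattice m1 m21 m2"
  proof
    show "relation_lattice m1 m21 m2 \<subseteq> L"
      using add[OF mul[OF m1(2)] mul[OF m21]] by (auto simp: relation_lattice_eq)
    have "(u, v) \<in> relation_lattice m1 m21 m2" if uv: "(u, v) \<in> L" for u v
    proof -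
      let ?t = "v div m2"
      have *: "(u - ?t * m21, v mod m2) \<in> L"
        using sub[OF uv m21, of ?t] by (simp add: minus_div_mult_eq_mod)
      then have v: "v mod m2 = 0" using m2_min m2(1) by simp
      let ?u = "u - ?t * m21"
      have "(?u mod m1, 0) \<in> L"
        using sub[OF *[unfolded v] m1(2), of "?u div m1"] by (simp add: minus_div_mult_eq_mod)
      then have "?u mod m1 = 0" using m1_min m1(1) by simp
      then have "?u = ?u div m1 * m1" "v = ?t * m2"
        using v minus_div_mult_eq_mod[of ?u m1] minus_div_mult_eq_mod[of v m2] by linarith+
      then have "(u, v) = (?u div m1 * m1 + ?t * m21, ?t * m2)" by simp
      then show ?thesis unfolding relation_lattice_eq by blast
    qed
    then show "L \<subseteq> relation_lattice m1 m21 m2" by auto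
  qed
  moreover have "0 \<le> m21" "m21 < m1" using m1(1) by (simp_all add: m21_def)
  ultimately show thesis using that[of m1 m2 m21] m1(1) m2(1) by simp
qed

lemma (in group) int_pow_commute:
  assumes "x \<in> carrier G" "y \<in> carrier G" "x \<otimes> y = y \<otimes> x"
  shows "x [^] (i :: int) \<otimes> y [^] (j :: int) = y [^] j \<otimes> x [^] i"
proof -
  have gen: "z [^] k \<in> generate G {z}" if "z \<in> carrier G" for z and k :: int
    using that by (auto simp: generate_pow)
  have "x [^] i \<otimes> y = y \<otimes> x [^] i"
    using centralizer_generate[of "{x}" y "x [^] i"] assms gen by blast
  then have "y [^] j \<otimes> x [^] i = x [^] i \<otimes> y [^] j"
    using centralizer_generate[of "{y}" "x [^] i" "y [^] j"] assms gen[OF assms(2)] by fastforce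
  then show ?thesis by simp
qed

context quandle
begin

text \<open>\<open>\<int>\<^sup>2\<close> acts on an orbit through the two translations \<open>- \<triangleleft> b\<close> and \<open>- \<triangleleft> c\<close>; the parameters
  describe the stabilizer of \<open>a\<close>, and the coset attached to \<open>x\<close> is \<open>{p. p \<cdot> a = x}\<close>.\<close>

lemma orbit_parameters:
  assumes fin: "finite Q" and ab: "abelian_quandle Q tri" and abc: "a \<in> Q" "b \<in> Q" "c \<in> Q"
    and cover: "\<And>x y. x \<in> quandle_orbit Q tri a \<Longrightarrow> y \<in> Q \<Longrightarrow> tri x y \<in> {x, tri x b, tri x c}"
  obtains m1 m21 m2 g where "1 \<le> m1" "1 \<le> m2" "0 \<le> m21" "m21 < m1"
    "bij_betw g (quandle_orbit Q tri a) (carrier (param_group m1 m21 m2))"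
    "\<And>x. x \<in> quandle_orbit Q tri a \<Longrightarrow>
      g (tri x b) = g x \<otimes>\<^bsub>param_group m1 m21 m2\<^esub> param_coset m1 m21 m2 (1, 0)"
    "\<And>x. x \<in> quandle_orbit Q tri a \<Longrightarrow>
      g (tri x c) = g x \<otimes>\<^bsub>param_group m1 m21 m2\<^esub> param_coset m1 m21 m2 (0, 1)"
proof -
  let ?Z = "integer_group \<times>\<times> integer_group" and ?B = "BijGroup Q"
  interpret Z: comm_group ?Z by (rule integer_group_pair)
  interpret B: group ?B by (rule group_BijGroup)
  define R where "R b = (\<lambda>a\<in>Q. tri a b)" for b
  have R: "R b \<in> carrier ?B" "R c \<in> carrier ?B"
    using translation_closed abc by (simp_all add: R_def)
  have "R b \<otimes>\<^bsub>?B\<^esub> R c = R c \<otimes>\<^bsub>?B\<^esub> R b"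
    using R ab abc by (auto simp: BijGroup_def compose_def R_def tri_closed abelian_quandle_def)
  note commute = B.int_pow_commute[OF R this]
  define T where "T p = R b [^]\<^bsub>?B\<^esub> fst p \<otimes>\<^bsub>?B\<^esub> R c [^]\<^bsub>?B\<^esub> snd p" for p :: "int \<times> int"
  have "T \<in> hom ?Z ?B"
  proof (rule homI)
    fix p q :: "int \<times> int"
    have "R b [^]\<^bsub>?B\<^esub> fst q \<otimes>\<^bsub>?B\<^esub> (R c [^]\<^bsub>?B\<^esub> snd p \<otimes>\<^bsub>?B\<^esub> R c [^]\<^bsub>?B\<^esub> snd q) =
        R c [^]\<^bsub>?B\<^esub> snd p \<otimes>\<^bsub>?B\<^esub> (R b [^]\<^bsub>?B\<^esub> fst q \<otimes>\<^bsub>?B\<^esub> R c [^]\<^bsub>?B\<^esub> snd q)"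
      using R commute[of "fst q" "snd p"] by (simp flip: B.m_assoc)
    then show "T (p \<otimes>\<^bsub>?Z\<^esub> q) = T p \<otimes>\<^bsub>?B\<^esub> T q"
      using R by (simp add: T_def mult_DirProd' B.int_pow_mult B.m_assoc)
  qed (simp add: T_def R)
  then interpret T: group_action ?Z Q T
    by (simp add: group_action_def group_hom_def group_hom_axioms_def Z.is_group group_BijGroup)
  have T_add: "T (u + u', v + v') x = T (u, v) (T (u', v') x)" if "x \<in> Q" for u u' v v' x
    using T.composition_rule[OF that, of "(u, v)" "(u', v')"] by simp
  have T_zero: "T (0, 0) x = x" if "x \<in> Q" for x
    using T.id_eq_one that by (metis one_DirProd one_integer_group restrict_apply')
  have T_closed: "T p x \<in> Q" if "x \<in> Q" for p x
    using T.element_image[of p x] that by simp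
  have T_b: "T (1, 0) x = tri x b" and T_c: "T (0, 1) x = tri x c" if "x \<in> Q" for x
    using R that by (simp_all add: T_def) (simp_all add: R_def)
  let ?O = "quandle_orbit Q tri a"
  have OQ: "?O \<subseteq> Q" using quandle_orbit_subset abc by simp
  \<comment> \<open>An equivalence, as required by \<open>quandle_orbit_induct\<close>; the action
    of \<open>q\<close> is undone by that of its negative.\<close>
  have orbit_T: "(\<exists>p. T p a = T q x) \<longleftrightarrow> (\<exists>p. T p a = x)" if x: "x \<in> Q" for q x
  proof
    obtain r s where q: "q = (r, s)" by (cases q)
    assume "\<exists>p. T p a = T q x"
    then obtain u v where "T (u, v) a = T (r, s) x" using q by auto
    then have "T (- r, - s) (T (u, v) a) = T (- r, - s) (T (r, s) x)" by simp
    also have "\<dots> = x" using T_add[OF x, of "- r" r "- s" s] T_zero x by simp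
    finally have "T (- r + u, - s + v) a = x" by (simp only: T_add[OF abc(1)])
    then show "\<exists>p. T p a = x" by blast
  next
    obtain r s where q: "q = (r, s)" by (cases q)
    assume "\<exists>p. T p a = x"
    then obtain u v where "T (u, v) a = x" by auto
    then have "T (r + u, s + v) a = T q x" using T_add abc q by simp
    then show "\<exists>p. T p a = T q x" by blast
  qed
  have trans: "\<exists>p. T p a = x" if "x \<in> ?O" for x
  proof -
    have "x \<in> ?O \<and> (\<exists>p. T p a = x)"
    proof (rule quandle_orbit_induct[OF abc(1) that])
      show "a \<in> ?O \<and> (\<exists>p. T p a = a)"
        using T_zero abc quandle_orbit_self by blast
      fix y d
      assume yd: "y \<in> Q" "d \<in> Q"
      have orb: "tri y d \<in> ?O \<longleftrightarrow> y \<in> ?O"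
        using quandle_orbit_tri[OF yd] quandle_orbit_self yd tri_closed quandle_orbit_eq abc(1)
        by metis
      have "(\<exists>p. T p a = tri y d) \<longleftrightarrow> (\<exists>p. T p a = y)" if "y \<in> ?O"
      proof -
        have "tri y d = y \<or> tri y d = T (1, 0) y \<or> tri y d = T (0, 1) y"
          using cover[OF that yd(2)] T_b[OF yd(1)] T_c[OF yd(1)] by auto
        then show ?thesis by (elim disjE) (simp_all only: orbit_T[OF yd(1)])
      qed
      then show "(tri y d \<in> ?O \<and> (\<exists>p. T p a = tri y d)) = (y \<in> ?O \<and> (\<exists>p. T p a = y))"
        using orb by blast
    qed
    then show ?thesis by blast
  qed
  have T_orbit: "T p a \<in> ?O" for p
  proof -
    have "R b \<in> generate ?B {R b | b. b \<in> Q}" "R c \<in> generate ?B {R b | b. b \<in> Q}"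
      using abc by (auto intro: generate.incl)
    then have "T p \<in> generate ?B {R b | b. b \<in> Q}"
      unfolding T_def R_def using translation_subgroup
      by (intro subgroup.m_closed[OF translation_subgroup] B.subgroup_int_pow_closed)
    then show ?thesis
      by (auto simp: quandle_orbit_def orbit_def translation_group_def R_def)
  qed
  define L where "L = stabilizer ?Z T a"
  have L: "subgroup L ?Z"
    unfolding L_def by (rule T.stabilizer_subgroup[OF abc(1)])
  have "finite (carrier ?B)"
  proof (rule finite_subset)
    show "carrier ?B \<subseteq> Q \<rightarrow>\<^sub>E Q"
      by (auto simp: BijGroup_def Bij_def PiE_def bij_betw_def)
    show "finite (Q \<rightarrow>\<^sub>E Q)" using fin by (simp add: finite_PiE)
  qed
  \<comment> \<open>The order of the finite group of bijections annihilates both translations, so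
    the stabilizer contains (n, 0) and (0, n).\<close>
  then have n: "int (order ?B) > 0" using B.order_gt_0_iff_finite by simp
  have "T (int (order ?B), 0) = \<one>\<^bsub>?B\<^esub>" "T (0, int (order ?B)) = \<one>\<^bsub>?B\<^esub>"
    using R B.pow_order_eq_1 by (simp_all add: T_def int_pow_int)
  then have "(int (order ?B), 0) \<in> L" "(0, int (order ?B)) \<in> L"
    using abc by (simp_all add: L_def stabilizer_def BijGroup_def)
  then obtain m1 m21 m2 where m: "1 \<le> m1" "1 \<le> m2" "0 \<le> m21" "m21 < m1"
    and Leq: "L = relation_lattice m1 m21 m2"
    using relation_lattice_basis[OF L n] by metis
  define g where "g x = {p. T p a = x}" for x
  have g: "g (T (u, v) a) = param_coset m1 m21 m2 (u, v)" for u v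
  proof (rule Set.set_eqI)
    fix p :: "int \<times> int"
    obtain r s where p: "p = (r, s)" by (cases p)
    have "T p a = T (u, v) a \<longleftrightarrow> (r - u, s - v) \<in> L"
    proof
      assume "T p a = T (u, v) a"
      then have "T (- u, - v) (T (r, s) a) = T (- u, - v) (T (u, v) a)" using p by simp
      then have "T (r - u, s - v) a = a"
        using T_add[OF abc(1), of "- u" _ "- v"] T_zero[OF abc(1)] by (simp flip: T_add[OF abc(1)])
      then show "(r - u, s - v) \<in> L" by (simp add: L_def stabilizer_def)
    next
      assume "(r - u, s - v) \<in> L"
      then have "T (r - u, s - v) a = a" by (simp add: L_def stabilizer_def)
      then have "T (u, v) (T (r - u, s - v) a) = T (u, v) a" by simp
      then show "T p a = T (u, v) a" using p by (simp flip: T_add[OF abc(1)])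
    qed
    also have "\<dots> \<longleftrightarrow> (\<exists>k l. p = (u + k * m1 + l * m21, v + l * m2))"
      unfolding Leq relation_lattice_eq p by (auto simp: algebra_simps)
    also have "\<dots> \<longleftrightarrow> p \<in> param_coset m1 m21 m2 (u, v)"
      by (simp only: param_coset_mem)
    finally show "p \<in> g (T (u, v) a) \<longleftrightarrow> p \<in> param_coset m1 m21 m2 (u, v)"
      by (simp add: g_def)
  qed
  have cases: "\<exists>u v. x = T (u, v) a" if "x \<in> ?O" for x
    using trans[OF that] by (metis surj_pair)
  show thesis
  proof (rule that[of m1 m2 m21 g])
    show "bij_betw g ?O (carrier (param_group m1 m21 m2))"
      unfolding bij_betw_def
    proof
      show "inj_on g ?O"
      proof (rule inj_onI)
        fix x y
        assume "x \<in> ?O" "g x = g y"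
        then show "x = y" using trans[of x] by (auto simp: g_def)
      qed
      have "param_coset m1 m21 m2 p \<in> g ` ?O" for p
        using g T_orbit by (metis image_eqI surj_pair)
      moreover have "g x \<in> range (param_coset m1 m21 m2)" if "x \<in> ?O" for x
        using cases[OF that] g by auto
      ultimately show "g ` ?O = carrier (param_group m1 m21 m2)"
        unfolding carrier_param_group by blast
    qed
    fix x
    assume "x \<in> ?O"
    then obtain u v where x: "x = T (u, v) a" using cases by blast
    have xQ: "x \<in> Q" using x T_closed abc by simp
    show "g (tri x b) = g x \<otimes>\<^bsub>param_group m1 m21 m2\<^esub> param_coset m1 m21 m2 (1, 0)"
      using T_b[OF xQ] T_add[OF abc(1), of 1 u 0 v] g[of "1 + u" v] g[of u v] x
      by (simp add: param_coset_mult add.commute)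
    show "g (tri x c) = g x \<otimes>\<^bsub>param_group m1 m21 m2\<^esub> param_coset m1 m21 m2 (0, 1)"
      using T_c[OF xQ] T_add[OF abc(1), of 0 u 1 v] g[of u "1 + v"] g[of u v] x
      by (simp add: param_coset_mult add.commute)
  qed (use m in auto)
qed

text \<open>Coordinates are chosen on each orbit separately and glued along the index of the orbit.
  This is compatible with \<open>tri\<close>, since a translation depends only on the orbit of the
  translating element.\<close>

lemma has_parameters_if_abelian:
  assumes fin: "finite Q" and ab: "abelian_quandle Q tri"
    and Orb: "bij_betw Orb {1..3} (quandle_orbits Q tri)"
  obtains m1 m21 m2 where "has_parameters Q tri Orb m1 m21 m2"
proof -
  define e where "e i = (SOME a. a \<in> Orb i)" for i
  have e: "e i \<in> Q" "Orb i = quandle_orbit Q tri (e i)" if "i \<in> {1..3}" for i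
  proof -
    have "Orb i \<in> quandle_orbits Q tri" using Orb that by (auto simp: bij_betw_def)
    then obtain a where a: "a \<in> Q" "Orb i = quandle_orbit Q tri a"
      by (auto simp: quandle_orbits_eq)
    have "e i \<in> quandle_orbit Q tri a"
      unfolding e_def a(2) using quandle_orbit_self[OF a(1)] by (rule someI)
    then show "e i \<in> Q" "Orb i = quandle_orbit Q tri (e i)"
      using a quandle_orbit_subset quandle_orbit_eq[OF a(1)] by auto
  qed
  define idx where "idx x = inv_into {1..3} Orb (quandle_orbit Q tri x)" for x
  have idx_Orb: "idx x = i" if "i \<in> {1..3}" "x \<in> Orb i" for i x
  proof -
    have "quandle_orbit Q tri x = Orb i"
      using e[OF that(1)] that(2) quandle_orbit_eq by simp
    then show ?thesis
      unfolding idx_def using Orb that(1) by (simp add: bij_betw_def inv_into_f_f)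
  qed
  have idx: "idx x \<in> {1..3}" "x \<in> Orb (idx x)" if "x \<in> Q" for x
  proof -
    have "quandle_orbit Q tri x \<in> Orb ` {1..3}"
      using Orb that by (auto simp: bij_betw_def quandle_orbits_eq)
    then show "idx x \<in> {1..3}" "x \<in> Orb (idx x)"
      unfolding idx_def using quandle_orbit_self[OF that]
      by (auto simp: inv_into_into f_inv_into_f simp del: atLeastAtMost_iff)
  qed
  have tri_e: "tri x y = tri x (e j)" if "x \<in> Q" "j \<in> {1..3}" "y \<in> Orb j" for x y j
    using abelian_tri_orbit[OF ab that(1) e(1)[OF that(2)]] e(2)[OF that(2)] that(3) by simp
  have tri_same: "tri x y = x" if "x \<in> Orb i" "y \<in> Orb i" "i \<in> {1..3}" for x y i
  proof -
    have "x \<in> Q" using that(1) e[OF that(3)] quandle_orbit_subset by auto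
    moreover have "y \<in> quandle_orbit Q tri x"
      using e[OF that(3)] that quandle_orbit_eq by simp
    ultimately show ?thesis using abelian_tri_same_orbit[OF ab] by simp
  qed
  \<comment> \<open>Cyclic successors within {1..3}: \<open>s i\<close> is i+1 and
    \<open>t i\<close> is i+2, the shift by 1 replacing residue 0 by 3.\<close>
  define s where "s i = i mod 3 + 1" for i :: nat
  define t where "t i = (i + 1) mod 3 + 1" for i :: nat
  have st: "s i \<in> {1..3}" "t i \<in> {1..3}" for i
    by (auto simp: s_def t_def)
  have index: "(j + 3 - i) mod 3 = 0 \<and> j = i \<or> (j + 3 - i) mod 3 = 1 \<and> j = s i \<or>
      (j + 3 - i) mod 3 = 2 \<and> j = t i"
    if "i \<in> {1..3}" "j \<in> {1..3}" for i j
  proof -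
    have "i = 1 \<or> i = 2 \<or> i = 3" "j = 1 \<or> j = 2 \<or> j = 3" using that by auto
    then show ?thesis by (elim disjE) (simp_all add: s_def t_def)
  qed
  \<comment> \<open>Bundled into one tuple so that a single choice over \<open>i\<close> provides
    all data.\<close>
  define P where "P i = (\<lambda>(m1, m21, m2, g). 1 \<le> m1 \<and> 1 \<le> m2 \<and> 0 \<le> m21 \<and> m21 < m1 \<and>
      bij_betw g (Orb i) (carrier (param_group m1 m21 m2)) \<and>
      (\<forall>x\<in>Orb i. g (tri x (e (s i))) = g x \<otimes>\<^bsub>param_group m1 m21 m2\<^esub> param_coset m1 m21 m2 (1, 0) \<and>
        g (tri x (e (t i))) = g x \<otimes>\<^bsub>param_group m1 m21 m2\<^esub> param_coset m1 m21 m2 (0, 1)))" for i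
  have "\<exists>F. P i F" if i: "i \<in> {1..3}" for i
  proof (rule orbit_parameters[OF fin ab e(1)[OF i] e(1)[OF st(1)] e(1)[OF st(2)]])
    fix x y
    assume x: "x \<in> quandle_orbit Q tri (e i)" and y: "y \<in> Q"
    then have "x \<in> Q" "x \<in> Orb i" using e[OF i] quandle_orbit_subset by auto
    \<comment> \<open>An element of the same orbit acts trivially; any other acts like the
      representative of the next orbit or of the one after.\<close>
    then show "tri x y \<in> {x, tri x (e (s i)), tri x (e (t i))}"
      using index[OF i idx(1)[OF y]] tri_e[OF _ idx[OF y], of x] tri_same[OF _ _ i, of x y] idx(2)[OF y]
      by (cases "idx y = i") (simp, auto)
  next
    fix m1 m21 m2 g
    assume "1 \<le> m1" "1 \<le> m2" "0 \<le> m21" "m21 < m1"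
      "bij_betw g (quandle_orbit Q tri (e i)) (carrier (param_group m1 m21 m2))"
      "\<And>x. x \<in> quandle_orbit Q tri (e i) \<Longrightarrow>
        g (tri x (e (s i))) = g x \<otimes>\<^bsub>param_group m1 m21 m2\<^esub> param_coset m1 m21 m2 (1, 0)"
      "\<And>x. x \<in> quandle_orbit Q tri (e i) \<Longrightarrow>
        g (tri x (e (t i))) = g x \<otimes>\<^bsub>param_group m1 m21 m2\<^esub> param_coset m1 m21 m2 (0, 1)"
    then have "P i (m1, m21, m2, g)" by (simp add: P_def e(2)[OF i])
    then show ?thesis by blast
  qed
  then obtain F where F: "\<And>i. i \<in> {1..3} \<Longrightarrow> P i (F i)" by metis
  define m1 m21 m2 g where "m1 i = fst (F i)" and "m21 i = fst (snd (F i))"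
    and "m2 i = fst (snd (snd (F i)))" and "g i = snd (snd (snd (F i)))" for i
  have P: "P i (m1 i, m21 i, m2 i, g i)" if "i \<in> {1..3}" for i
    using F[OF that] by (simp add: m1_def m21_def m2_def g_def)
  define f where "f x = (idx x, g (idx x) x)" for x
  have g_bij: "bij_betw (g i) (Orb i) (carrier (param_group (m1 i) (m21 i) (m2 i)))"
    if "i \<in> {1..3}" for i
    using P[OF that] by (simp add: P_def)
  have f_Orb: "f ` Orb i = {i} \<times> carrier (param_group (m1 i) (m21 i) (m2 i))" if "i \<in> {1..3}" for i
  proof -
    have "f ` Orb i = Pair i ` g i ` Orb i"
      using idx_Orb[OF that] by (simp add: f_def image_image)
    then show ?thesis using g_bij[OF that] by (auto simp: bij_betw_def)
  qed
  have "bij_betw f Q (param_carrier m1 m21 m2)"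
    unfolding bij_betw_def
  proof
    show "inj_on f Q"
    proof (rule inj_onI)
      fix x y
      assume xy: "x \<in> Q" "y \<in> Q" "f x = f y"
      have pair: "idx x = idx y \<and> g (idx x) x = g (idx y) y"
        using xy(3) unfolding f_def prod.inject .
      note eq = conjunct1[OF pair, symmetric]
      have "g (idx x) x = g (idx x) y" using conjunct2[OF pair] unfolding eq .
      then show "x = y"
        using bij_betw_imp_inj_on[OF g_bij[OF idx(1)[OF xy(1)]]] idx(2)[OF xy(1)]
          idx(2)[OF xy(2)] eq by (metis inj_onD)
    qed
    have "Orb i \<subseteq> Q" if "i \<in> {1..3}" for i
      using e[OF that] quandle_orbit_subset by simp
    then have "Q = (\<Union>i\<in>{1..3}. Orb i)"
      using idx by blast
    then have "f ` Q = (\<Union>i\<in>{1..3}. f ` Orb i)" by (simp add: image_UN)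
    also have "\<dots> = param_carrier m1 m21 m2"
      using f_Orb by (auto simp: param_carrier_def simp del: atLeastAtMost_iff)
    finally show "f ` Q = param_carrier m1 m21 m2" .
  qed
  moreover have "f (tri x y) = param_op m1 m21 m2 (f x) (f y)" if xy: "x \<in> Q" "y \<in> Q" for x y
  proof -
    let ?i = "idx x" and ?j = "idx y"
    note i = idx[OF xy(1)] and j = idx[OF xy(2)]
    have "tri x y \<in> Orb ?i"
      using tri_in_quandle_orbit[OF xy] quandle_orbit_eq[OF e(1)[OF i(1)], of x] e(2)[OF i(1)] i(2)
      by simp
    then have "f (tri x y) = (?i, g ?i (tri x y))"
      using idx_Orb[OF i(1)] by (simp add: f_def)
    also have "g ?i (tri x y) = g ?i x \<otimes>\<^bsub>param_group (m1 ?i) (m21 ?i) (m2 ?i)\<^esub>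
        param_gen (m1 ?i) (m21 ?i) (m2 ?i) ((?j + 3 - ?i) mod 3)"
    proof -
      obtain u v where gx: "g ?i x = param_coset (m1 ?i) (m21 ?i) (m2 ?i) (u, v)"
        using bij_betwE[OF g_bij[OF i(1)]] i(2) by (force simp: carrier_param_group)
      show ?thesis
        using index[OF i(1) j(1)]
      proof (elim disjE conjE)
        assume 1: "(?j + 3 - ?i) mod 3 = 0" "?j = ?i"
        have "y \<in> Orb ?i" using j(2) unfolding 1(2) .
        then have "tri x y = x" by (rule tri_same[OF i(2) _ i(1)])
        then show ?thesis unfolding 1(1) param_gen_eq by (simp add: gx param_coset_mult)
      next
        assume "(?j + 3 - ?i) mod 3 = 1" "?j = s ?i"
        then show ?thesis
          using P[OF i(1)] i(2) unfolding tri_e[OF xy(1) j] P_def prod.case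
          by (simp add: param_gen_eq)
      next
        assume "(?j + 3 - ?i) mod 3 = 2" "?j = t ?i"
        then show ?thesis
          using P[OF i(1)] i(2) unfolding tri_e[OF xy(1) j] P_def prod.case
          by (simp add: param_gen_eq)
      qed
    qed
    finally show ?thesis
      unfolding f_def[of x] f_def[of y] param_op_def prod.case .
  qed
  ultimately have "f \<in> quandle_isos Q tri (param_carrier m1 m21 m2) (param_op m1 m21 m2)"
    by (simp add: quandle_isos_def)
  moreover have "\<forall>i\<in>{1..3}. 1 \<le> m1 i \<and> 1 \<le> m2 i \<and> 0 \<le> m21 i \<and> m21 i < m1 i"
    using P by (simp add: P_def)
  ultimately have "has_parameters Q tri Orb m1 m21 m2"
    unfolding has_parameters_def using f_Orb by blast
  then show thesis by (rule that)
qed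

end

theorem theorem5p1:
  fixes Q :: "'a set" and tri :: "'a \<Rightarrow> 'a \<Rightarrow> 'a" and Orb :: "nat \<Rightarrow> 'a set"
  assumes "quandle Q tri" and "finite Q"
    and "orbit_ordering Q tri Orb"
  shows "structure_group Q tri \<cong> integer_group \<times>\<times> integer_group \<times>\<times> integer_group
    \<longleftrightarrow>
    abelian_quandle Q tri \<and> card (quandle_orbits Q tri) = 3 \<and>
    (\<exists>m1 m21 m2. has_parameters Q tri Orb m1 m21 m2 \<and>
      (Gcd {m1 1, m21 1, m2 2} = 1 \<and>
       Gcd {m2 1, m1 3, m21 3} = 1 \<and>
       Gcd {m1 2, m21 2, m2 3} = 1) \<and>
      (Gcd {m1 1, m21 1, m1 2, m2 3} = 1 \<and>
       Gcd {m1 1, m2 2, m1 3, m21 3} = 1 \<and>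
       Gcd {m2 1, m1 2, m21 2, m1 3} = 1) \<and>
      Gcd {m1 1, m1 2, m1 3, m21 1 * m21 2 * m21 3 - m2 1 * m2 2 * m2 3} = 1)"
proof -
  interpret quandle Q tri by fact
  \<comment> \<open>Holds for every choice of parameters, so the existence statement below suffices
    to pass to the existential in the theorem.\<close>
  have coprime: "comm_group (structure_group Q tri) \<longleftrightarrow> coprime_params m1 m21 m2"
    if ab: "abelian_quandle Q tri" and card: "card (quandle_orbits Q tri) = 3"
      and params: "has_parameters Q tri Orb m1 m21 m2" for m1 m21 m2
  proof -
    obtain f where f: "f \<in> quandle_isos Q tri (param_carrier m1 m21 m2) (param_op m1 m21 m2)"
      "\<forall>i\<in>{1..3}. f ` Orb i = {i} \<times> carrier (param_group (m1 i) (m21 i) (m2 i))"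
      using params unfolding has_parameters_def by blast
    interpret P: parametrized_quandle Q tri Orb m1 m21 m2 f
      by unfold_locales
        (use card f params assms(3) in \<open>auto simp: has_parameters_def orbit_ordering_def\<close>)
    interpret G: group "structure_group Q tri" by (rule group_structure_group)
    interpret R: parametrized_quandle_rep Q tri Orb m1 m21 m2 f "structure_group Q tri" "structure_gen Q tri"
      by unfold_locales (use ab structure_gen_closed structure_gen_rel in auto)
    show ?thesis
      using P.coprime_params_if_comm_structure_group R.comm_group_if_coprime_params
        generate_structure_gen by blast
  qed
  have params: "\<exists>m1 m21 m2. has_parameters Q tri Orb m1 m21 m2"
    if "abelian_quandle Q tri" "card (quandle_orbits Q tri) = 3"
    using that has_parameters_if_abelian assms(2,3) unfolding orbit_ordering_def by metis
  have "structure_group Q tri \<cong> integer_group \<times>\<times> integer_group \<times>\<times> integer_group \<longleftrightarrow>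
      abelian_quandle Q tri \<and> card (quandle_orbits Q tri) = 3 \<and>
      (\<exists>m1 m21 m2. has_parameters Q tri Orb m1 m21 m2 \<and> coprime_params m1 m21 m2)"
    unfolding structure_group_iso_integer_triple_iff[OF assms(2)]
    using coprime params abelian_quandle_if_comm_structure_group by blast
  then show ?thesis unfolding coprime_params_def .
qed

end
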